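(* Let $R\ge R_0=\|x^0-x^*\|$, $Q=B_{4R}(x^* )$, and assume that $\mathbb{E}\|F_\xi(x)-F(x)\|^2\le\sigma^2$ for all $x\in Q$, $\|F(x)-F(y)\|\le L\|x-y\|$ for all $x,y\in Q$, and $\langle F(x)-F(y),x-y\rangle\ge0$ for all $x,y\in Q$. Let $K\ge0$ be an integer and $\beta\in(0,1]$ with $\ln\frac{6(K+1)}\beta\ge1$. Consider clipped-SEG with $\gamma_1=\gamma_2=\gamma$, $m_{1,k}=m_{2,k}\equiv m$, $\lambda_{1,k}=\lambda_{2,k}\equiv\lambda=\frac R{20\gamma\ln\frac{6(K+1)}\beta}$. Let $\widetilde x^K_{\rm avg}=\frac1{K+1}\sum_{k=0}^K\widetilde x^k$. Call (a) the condition $0<\gamma\le\frac1{160L\ln\frac{6(K+1)}\beta}$ and (b) the condition $m\ge\max\left\{1,\frac{10800(K+1)\gamma^2\sigma^2\ln\frac{6(K+1)}\beta}{R^2}\right\}$. 1. (Large stepsize/large batch.) The choice $$\gamma=\frac1{160L\ln\frac{6(K+1)}\beta},\qquad m=\max\left\{1,\frac{27(K+1)\sigma^2}{64L^2R^2\ln\frac{6(K+1)}\beta}\right\}$$ satisfies (a) and (b), and with this choice, after $K$ iterations, with probability at least $1-\beta$ $$\mathrm{Gap}_R(\widetilde x^K_{\rm avg})\le\frac{720LR^2\ln\frac{6(K+1)}\beta}{K+1}.$$ In particular, to guarantee $\mathrm{Gap}_R(\widetilde x^K_{\rm avg})\le\varepsilon$ with probability at least $1-\beta$ for $\varepsilon>0$,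 clipped-SEG requires $O\left(\frac{LR^2}\varepsilon\ln\left(\frac{LR^2}{\varepsilon\beta}\right)\right)$ iterations and $O\left(\max\left\{\frac{LR^2}\varepsilon,\frac{\sigma^2R^2}{\varepsilon^2}\right\}\ln\left(\frac{LR^2}{\varepsilon\beta}\right)\right)$ oracle calls. 2. (Small stepsize/small batch.) The choice $$\gamma=\min\left\{\frac1{160L\ln\frac{6(K+1)}\beta},\frac R{60\sigma\sqrt{3(K+1)\ln\frac{6(K+1)}\beta}}\right\},\qquad m=1$$ satisfies (a) and (b), and with this choice, after $K$ iterations, with probability at least $1-\beta$ $$\mathrm{Gap}_R(\widetilde x^K_{\rm avg})\le\max\left\{\frac{720LR^2\ln\frac{6(K+1)}\beta}{K+1},\frac{270\sigma R\sqrt{3\ln\frac{6(K+1)}\beta}}{\sqrt{K+1}}\right\}.$$ In particular, to guarantee $\mathrm{Gap}_R(\widetilde x^K_{\rm avg})\le\varepsilon$ with probability at least $1-\beta$ for $\varepsilon>0$, clipped-SEG requires $O\left(\max\left\{\frac{LR^2}\varepsilon\ln\left(\frac{LR^2}{\varepsilon\beta}\right),\frac{\sigma^2R^2}{\varepsilon^2}\ln\left(\frac{\sigma^2R^2}{\varepsilon^2\beta}\right)\right\}\right)$ iterations/oracle calls.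
   Context: Notation: $\|\cdot\|$ is the Euclidean norm, $B_r(x)=\{u\in\mathbb{R}^d:\|u-x\|\le r\}$. $F:\mathbb{R}^d\to\mathbb{R}^d$ with $F(x)=\mathbb{E}_{\xi\sim\mathcal D}[F_\xi(x)]$ for all $x$, where $F_\xi(x)$ is a stochastic oracle. $\mathcal X^*=\{x:F(x)=0\}$ is nonempty, $x^0$ is the starting point, $x^*$ is the projection of $x^0$ onto $\mathcal X^*$. $\mathrm{Gap}_R(x)=\max_{y\in B_R(x^* )}\langle F(y),x-y\rangle$. $\mathrm{clip}(y,\lambda)=\min\{1,\lambda/\|y\|\}y$ for $y\ne0$, $\mathrm{clip}(0,\lambda)=0$, for $\lambda>0$. clipped-SEG, for $k=0,1,\dots$: $\widetilde x^k=x^k-\gamma_1\widetilde F_{\boldsymbol\xi_1^k}(x^k)$, $x^{k+1}=x^k-\gamma_2\widetilde F_{\boldsymbol\xi_2^k}(\widetilde x^k)$, where $\widetilde F_{\boldsymbol\xi_1^k}(x^k)=\mathrm{clip}\left(\frac1{m_{1,k}}\sum_{i=1}^{m_{1,k}}F_{\xi_1^{i,k}}(x^k),\lambda_{1,k}\right)$, $\widetilde F_{\boldsymbol\xi_2^k}(\widetilde x^k)=\mathrm{clip}\left(\frac1{m_{2,k}}\sum_{i=1}^{m_{2,k}}F_{\xi_2^{i,k}}(\widetilde x^k),\lambda_{2,k}\right)$ and all $\xi_1^{i,k},\xi_2^{i,k}$ are independent samples from $\mathcal D$. Clipping levels are positive (so $R>0$); batchsizes are positive integers (a non-integer prescribed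 batchsize is rounded up). An oracle call is one evaluation of some $F_\xi(x)$; the total number of oracle calls is $2m(K+1)$. "Requires $O(N)$ iterations (oracle calls)" means that there is a $K$ for which the stated choice of parameters gives the guarantee with at most $O(N)$ iterations (oracle calls), where $O(\cdot)$ hides absolute constants; these bounds are understood for $\varepsilon$ small enough that the arguments of the logarithms are at least 2. For $\sigma=0$ fractions with $\sigma$ in the denominator are read as $+\infty$, and terms proportional to $\sigma$ as $0$.
   Formalization: The oracle-call bounds (not the iteration bounds) are proved only for ε ≤ LR² in part 1 and ε ≤ max{LR², σR} in part 2; otherwise they can fail, e.g. σ=0, L=R=1, ε=1/(2β), β→0, where the bound tends to 0 but at least 2 calls are made. *)

theory Defs
  imports "HOL-Probability.Probability"
begin

definition clip :: "'a::real_normed_vector \<Rightarrow> real \<Rightarrow> 'a" where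
  "clip y lam = (if y = 0 then 0 else min 1 (lam / norm y) *\<^sub>R y)"

text \<open>Since \<open>F\<close> is continuous on the ball in all uses below, the supremum is a maximum.\<close>

definition gap :: "('a::euclidean_space \<Rightarrow> 'a) \<Rightarrow> 'a \<Rightarrow> real \<Rightarrow> 'a \<Rightarrow> real" where
  "gap F xstar R x = (SUP y\<in>cball xstar R. F y \<bullet> (x - y))"

definition minibatch ::
    "('s \<Rightarrow> 'a::real_normed_vector \<Rightarrow> 'a) \<Rightarrow> nat \<Rightarrow> (nat \<Rightarrow> 's) \<Rightarrow> 'a \<Rightarrow> 'a" where
  "minibatch G m s x = (1 / real m) *\<^sub>R (\<Sum>i=1..m. G (s i) x)"

text \<open>
  Clipped-SEG along one realisation of the samples: \<open>s1 k i\<close> and \<open>s2 k i\<close> are the \<open>i\<close>-th samples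
  (\<open>i = 1, 2, \<dots>\<close>) of the extrapolation and of the update step of iteration \<open>k\<close>.
\<close>

definition seg_extrapolate ::
    "('s \<Rightarrow> 'a::real_normed_vector \<Rightarrow> 'a) \<Rightarrow> real \<Rightarrow> (nat \<Rightarrow> nat) \<Rightarrow> (nat \<Rightarrow> real) \<Rightarrow>
     (nat \<Rightarrow> nat \<Rightarrow> 's) \<Rightarrow> nat \<Rightarrow> 'a \<Rightarrow> 'a" where
  "seg_extrapolate G \<gamma>1 m1 lam1 s1 k x =
     x - \<gamma>1 *\<^sub>R clip (minibatch G (m1 k) (s1 k) x) (lam1 k)"

primrec seg_iterate ::
    "('s \<Rightarrow> 'a::real_normed_vector \<Rightarrow> 'a) \<Rightarrow> real \<Rightarrow> real \<Rightarrow> (nat \<Rightarrow> nat) \<Rightarrow> (nat \<Rightarrow> nat) \<Rightarrow>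
     (nat \<Rightarrow> real) \<Rightarrow> (nat \<Rightarrow> real) \<Rightarrow> (nat \<Rightarrow> nat \<Rightarrow> 's) \<Rightarrow> (nat \<Rightarrow> nat \<Rightarrow> 's) \<Rightarrow> 'a \<Rightarrow> nat \<Rightarrow> 'a" where
  "seg_iterate G \<gamma>1 \<gamma>2 m1 m2 lam1 lam2 s1 s2 x0 0 = x0"
| "seg_iterate G \<gamma>1 \<gamma>2 m1 m2 lam1 lam2 s1 s2 x0 (Suc k) =
     (let x = seg_iterate G \<gamma>1 \<gamma>2 m1 m2 lam1 lam2 s1 s2 x0 k;
          xt = seg_extrapolate G \<gamma>1 m1 lam1 s1 k x
      in x - \<gamma>2 *\<^sub>R clip (minibatch G (m2 k) (s2 k) xt) (lam2 k))"

definition seg_average ::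
    "('s \<Rightarrow> 'a::real_normed_vector \<Rightarrow> 'a) \<Rightarrow> real \<Rightarrow> real \<Rightarrow> (nat \<Rightarrow> nat) \<Rightarrow> (nat \<Rightarrow> nat) \<Rightarrow>
     (nat \<Rightarrow> real) \<Rightarrow> (nat \<Rightarrow> real) \<Rightarrow> (nat \<Rightarrow> nat \<Rightarrow> 's) \<Rightarrow> (nat \<Rightarrow> nat \<Rightarrow> 's) \<Rightarrow> 'a \<Rightarrow> nat \<Rightarrow> 'a" where
  "seg_average G \<gamma>1 \<gamma>2 m1 m2 lam1 lam2 s1 s2 x0 K =
     (1 / (real K + 1)) *\<^sub>R
       (\<Sum>k=0..K. seg_extrapolate G \<gamma>1 m1 lam1 s1 k
                   (seg_iterate G \<gamma>1 \<gamma>2 m1 m2 lam1 lam2 s1 s2 x0 k))"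

definition log_factor :: "nat \<Rightarrow> real \<Rightarrow> real" where
  "log_factor K \<beta> = ln (6 * (real K + 1) / \<beta>)"

definition clip_level :: "real \<Rightarrow> nat \<Rightarrow> real \<Rightarrow> real \<Rightarrow> real" where
  "clip_level R K \<beta> \<gamma> = R / (20 * \<gamma> * log_factor K \<beta>)"

text \<open>
  Probability of \<open>gap \<le> b\<close> at the averaged point, for equal stepsizes \<open>\<gamma>\<close>, constant batchsize \<open>m\<close>
  and constant clipping level. The samples are random variables on \<open>M\<close>.
\<close>

definition seg_success_prob ::
    "'w measure \<Rightarrow> ('s \<Rightarrow> 'a::euclidean_space \<Rightarrow> 'a) \<Rightarrow> ('a \<Rightarrow> 'a) \<Rightarrow>
     (nat \<Rightarrow> nat \<Rightarrow> 'w \<Rightarrow> 's) \<Rightarrow> (nat \<Rightarrow> nat \<Rightarrow> 'w \<Rightarrow> 's) \<Rightarrow> 'a \<Rightarrow> 'a \<Rightarrow> real \<Rightarrow> real \<Rightarrow>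
     nat \<Rightarrow> real \<Rightarrow> nat \<Rightarrow> real \<Rightarrow> real" where
  "seg_success_prob M G F xi1 xi2 x0 xstar R \<beta> K \<gamma> m b =
     measure M {w \<in> space M.
       gap F xstar R
         (seg_average G \<gamma> \<gamma> (\<lambda>_. m) (\<lambda>_. m)
            (\<lambda>_. clip_level R K \<beta> \<gamma>) (\<lambda>_. clip_level R K \<beta> \<gamma>)
            (\<lambda>k i. xi1 k i w) (\<lambda>k i. xi2 k i w) x0 K) \<le> b}"

definition stepsize_cond :: "real \<Rightarrow> nat \<Rightarrow> real \<Rightarrow> real \<Rightarrow> bool" where
  "stepsize_cond L K \<beta> \<gamma> \<longleftrightarrow> 0 < \<gamma> \<and> \<gamma> \<le> 1 / (160 * L * log_factor K \<beta>)"

definition batch_cond :: "real \<Rightarrow> real \<Rightarrow> nat \<Rightarrow> real \<Rightarrow> real \<Rightarrow> nat \<Rightarrow> bool" where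
  "batch_cond R \<sigma> K \<beta> \<gamma> m \<longleftrightarrow>
     real m \<ge> max 1 (10800 * (real K + 1) * \<gamma>\<^sup>2 * \<sigma>\<^sup>2 * log_factor K \<beta> / R\<^sup>2)"

definition large_stepsize :: "real \<Rightarrow> nat \<Rightarrow> real \<Rightarrow> real" where
  "large_stepsize L K \<beta> = 1 / (160 * L * log_factor K \<beta>)"

definition large_batch :: "real \<Rightarrow> real \<Rightarrow> real \<Rightarrow> nat \<Rightarrow> real \<Rightarrow> nat" where
  "large_batch L R \<sigma> K \<beta> =
     nat \<lceil>max 1 (27 * (real K + 1) * \<sigma>\<^sup>2 / (64 * L\<^sup>2 * R\<^sup>2 * log_factor K \<beta>))\<rceil>"

text \<open>For \<open>\<sigma> = 0\<close> the second entry of the minimum is read as \<open>+\<infinity>\<close>.\<close>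

definition small_stepsize :: "real \<Rightarrow> real \<Rightarrow> real \<Rightarrow> nat \<Rightarrow> real \<Rightarrow> real" where
  "small_stepsize L R \<sigma> K \<beta> =
     (if \<sigma> = 0 then 1 / (160 * L * log_factor K \<beta>)
      else min (1 / (160 * L * log_factor K \<beta>))
               (R / (60 * \<sigma> * sqrt (3 * (real K + 1) * log_factor K \<beta>))))"

definition oracle_calls :: "nat \<Rightarrow> nat \<Rightarrow> nat" where
  "oracle_calls m K = 2 * m * (K + 1)"

text \<open>
  The constant hidden in \<open>O(\<cdot>)\<close>. An existentially quantified constant inside a statement
  that is polymorphic in the dimension and in the sample spaces could depend on these types;
  naming a numeral makes it absolute. Its value is generous and has no significance.
\<close>

definition O_const :: real where
  "O_const = 10 ^ 12"

end

theory Submission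
  imports Defs
begin

text \<open>
  Write \<open>l = log_factor K \<beta>\<close>, let \<open>\<omega>\<close>, \<open>\<theta>\<close> be the stepsize times the estimation errors of the
  extrapolation and of the update step, \<open>S\<close> the running sum of the \<open>\<theta>\<close>, and let \<open>V\<close> grow by
  \<open>2 \<langle>\<theta>, xt - x* + S\<rangle> + 4 |\<theta>|\<^sup>2 + 3 |\<omega>|\<^sup>2\<close> in each iteration, where \<open>xt\<close> is the extrapolated point.
  Expanding squares, \<open>|x - x*|\<^sup>2 + |S|\<^sup>2 \<le> R\<^sup>2 + V\<close> as long as the iterates stay in the ball where \<open>F\<close>
  is monotone and Lipschitz, and \<open>2 \<gamma> (K + 1)\<close> times the gap is at most \<open>5 R\<^sup>2 + V\<close>. So a single bound
  \<open>V \<le> 3 R\<^sup>2\<close> at the final time controls everything, provided the process is frozen once \<open>x\<close> or \<open>S\<close>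
  becomes too large: then \<open>|x - x*|, |S| \<le> 2 R\<close> at the end, so it was never frozen. Clipping
  at level \<open>\<lambda>\<close> makes the increments of \<open>(l / R\<^sup>2) V\<close> bounded by an absolute constant; it is the projection
  onto a ball containing the value of \<open>F\<close>, hence does not increase the error, and its bias is at most variance over \<open>2 \<lambda>\<close>. Together
  with \<open>exp y \<le> 1 + y + y\<^sup>2\<close> this gives \<open>E exp ((l / R\<^sup>2) V) \<le> exp l\<close>, and Markov's inequality concludes.
\<close>

section \<open>Clipping\<close>

lemma norm_clip_le:
  fixes y :: "'a::real_normed_vector"
  assumes "0 \<le> r"
  shows "norm (clip y r) \<le> r"
proof (cases "norm y \<le> r")
  case True
  then show ?thesis using assms by (auto simp: clip_def field_simps min_def)
next
  case False
  then have "y \<noteq> 0" and "r / norm y < 1" using assms by (auto simp: divide_less_eq)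
  then show ?thesis using assms by (simp add: clip_def)
qed

lemma clip_eq_self: "norm y \<le> r \<Longrightarrow> clip y r = y"
  by (auto simp: clip_def min_def field_simps)

lemma clip_eq_scaleR:
  assumes "0 \<le> r" "r < norm y"
  shows "clip y r = (r / norm y) *\<^sub>R y"
  using assms by (auto simp: clip_def min_def field_simps)

text \<open>Clipping at level \<open>r\<close> is the metric projection onto the ball of radius
  \<open>r\<close> around 0, and a projection moves no point away from a point of the set.\<close>

lemma norm_diff_clip_le:
  fixes f y :: "'a::real_inner"
  assumes "norm f \<le> r"
  shows "norm (f - clip y r) \<le> norm (f - y)"
proof (cases "norm y \<le> r")
  case False
  define t where "t = r / norm y"
  have r: "0 \<le> r" using assms norm_ge_zero[of f] by linarith
  have y: "0 < norm y" using False r by linarith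
  have t: "0 \<le> t" "t \<le> 1" "t * norm y = r"
    using False r y by (auto simp: t_def)
  have "f \<bullet> y \<le> r * norm y"
    using norm_cauchy_schwarz[of f y] assms mult_right_mono[OF assms, of "norm y"] norm_ge_zero[of y]
    by linarith
  \<comment> \<open>For \<open>t = r / norm y\<close> the difference of the two squared distances is
    \<open>1 - t\<close> times this quantity.\<close>
  then have "0 \<le> (norm y)\<^sup>2 + r * norm y - 2 * (f \<bullet> y)"
    using False mult_right_mono[of r "norm y" "norm y"] by (simp add: power2_eq_square)
  then have "0 \<le> (1 - t) * ((norm y)\<^sup>2 + r * norm y - 2 * (f \<bullet> y))"
    using t by (intro mult_nonneg_nonneg) auto
  also have "\<dots> = (1 - t) * ((norm y)\<^sup>2 + t * (norm y)\<^sup>2 - 2 * (f \<bullet> y))"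
    by (simp add: power2_eq_square flip: t(3))
  also have "\<dots> = (norm (f - y))\<^sup>2 - (norm (f - t *\<^sub>R y))\<^sup>2"
    by (simp only: power2_norm_eq_inner)
       (simp add: inner_diff_left inner_diff_right inner_commute algebra_simps)
  finally have "(norm (f - t *\<^sub>R y))\<^sup>2 \<le> (norm (f - y))\<^sup>2" by simp
  then show ?thesis
    using False r by (simp add: clip_eq_scaleR t_def power2_le_iff_abs_le)
qed (simp add: clip_eq_self)

text \<open>If clipping is active, the part cut off has length
  \<open>norm y - r \<le> d - r / 2\<close> for \<open>d = norm (y - f)\<close>, and
  \<open>d - r / 2 \<le> d\<^sup>2 / (2 * r)\<close> because \<open>(d - r)\<^sup>2 \<ge> 0\<close>.
  In expectation this bounds the bias of clipping.\<close>

lemma clip_residual_le: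
  fixes f y :: "'a::real_inner"
  assumes "norm f \<le> r / 2" "0 < r"
  shows "norm (y - clip y r) \<le> (norm (y - f))\<^sup>2 / (2 * r)"
proof (cases "norm y \<le> r")
  case False
  have "y - clip y r = (1 - r / norm y) *\<^sub>R y"
    using False assms by (subst clip_eq_scaleR) (auto simp: algebra_simps)
  then have "norm (y - clip y r) = (1 - r / norm y) * norm y"
    using False assms by (simp add: divide_le_eq)
  also have "\<dots> = norm y - r"
  proof -
    have "norm y \<noteq> 0" using False assms(2) by linarith
    then show ?thesis by (simp only: left_diff_distrib) simp
  qed
  also have "\<dots> \<le> norm (y - f) - r / 2"
    using norm_triangle_ineq2[of y f] assms by linarith
  also have "\<dots> \<le> (norm (y - f))\<^sup>2 / (2 * r)"
    using assms(2) zero_le_power2[of "norm (y - f) - r"]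
    by (simp add: field_simps power2_eq_square)
  finally show ?thesis .
qed (use assms in \<open>simp add: clip_eq_self\<close>)

section \<open>Exponential moments of clipped estimators\<close>

lemma exp_le_quadratic:
  fixes x :: real
  assumes "\<bar>x\<bar> \<le> 1"
  shows "exp x \<le> 1 + x + x\<^sup>2"
proof (cases "0 \<le> x")
  case True
  then show ?thesis using assms by (intro exp_bound) auto
next
  case False
  define y where "y = - x"
  have y: "0 \<le> y" using False by (simp add: y_def)
  \<comment> \<open>For negative arguments the claim reads
    \<open>1 \<le> (1 - y + y\<^sup>2) * exp y\<close>; with the quadratic Taylor polynomial in
    place of \<open>exp y\<close>, the product expands to 1 plus nonnegative terms.\<close>
  have "1 \<le> (1 - y + y\<^sup>2) * (1 + y + y\<^sup>2 / 2)"
  proof -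
    have "(1 - y + y\<^sup>2) * (1 + y + y\<^sup>2 / 2) = 1 + y\<^sup>2 / 2 + y ^ 3 / 2 + y ^ 4 / 2"
      by (simp add: power2_eq_square power3_eq_cube power4_eq_xxxx distrib_left distrib_right
            left_diff_distrib add_divide_distrib diff_divide_distrib)
    then show ?thesis using y by simp
  qed
  also have "\<dots> \<le> (1 - y + y\<^sup>2) * exp y"
  proof (rule mult_left_mono)
    show "1 + y + y\<^sup>2 / 2 \<le> exp y" using y by (rule exp_lower_Taylor_quadratic)
    have "0 \<le> (1 - y / 2)\<^sup>2 + 3 / 4 * y\<^sup>2" by simp
    also have "\<dots> = 1 - y + y\<^sup>2" by (simp add: power2_eq_square field_simps)
    finally show "0 \<le> 1 - y + y\<^sup>2" .
  qed
  finally show ?thesis by (simp add: y_def exp_minus field_simps)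
qed

text \<open>A Bernstein-type bound. The exponent is at most 1 in absolute value, so
  \<open>exp_le_quadratic\<close> applies pointwise. The linear part is the centred
  \<open>(f - Y w) \<bullet> z\<close>, which integrates to 0, plus the clipping bias; everything
  else is at most a constant times \<open>(norm (Y w - f))\<^sup>2\<close>. The number
  \<open>q\<close> bounds the exponent relative to \<open>norm (f - clip (Y w) r)\<close>.\<close>

lemma clip_exp_moment:
  fixes Y :: "'w \<Rightarrow> 'a::euclidean_space"
  assumes P: "prob_space P" and Y: "integrable P Y" and EY: "(LINT w|P. Y w) = f"
    and v: "(\<integral>\<^sup>+ w. ennreal ((norm (Y w - f))\<^sup>2) \<partial>P) \<le> ennreal v" and "0 \<le> v"
    and f: "norm f \<le> r / 2" and r: "0 < r" and b: "0 \<le> b"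
    and q: "norm z + 3 / 2 * b * r \<le> q" "3 / 2 * q * r \<le> 1"
  shows "(\<integral>\<^sup>+ w. ennreal (exp ((f - clip (Y w) r) \<bullet> z + b * (norm (f - clip (Y w) r))\<^sup>2)) \<partial>P)
           \<le> ennreal (exp ((q / (2 * r) + b + q\<^sup>2) * v))"
proof -
  interpret prob_space P by fact
  \<comment> \<open>The summands pay for the clipping bias, the quadratic term of the exponent, and
    the square of the exponent.\<close>
  define C where "C = q / (2 * r) + b + q\<^sup>2"
  have q0: "norm z \<le> q" "0 \<le> q"
    using q(1) b r norm_ge_zero[of z] by (smt (verit) mult_nonneg_nonneg divide_nonneg_nonneg)+
  have C0: "0 \<le> C" using q0 b r by (simp add: C_def)
  have [measurable]: "Y \<in> borel_measurable P" using Y by auto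
  have pw: "exp ((f - clip y r) \<bullet> z + b * (norm (f - clip y r))\<^sup>2)
              \<le> 1 + (f - y) \<bullet> z + C * (norm (y - f))\<^sup>2" for y
  proof -
    define t where "t = f - clip y r"
    define e where "e = t \<bullet> z + b * (norm t)\<^sup>2"
    have t1: "norm t \<le> norm (y - f)"
      unfolding t_def using norm_diff_clip_le[of f r y] f r by (simp add: norm_minus_commute)
    have t2: "norm t \<le> 3 / 2 * r"
      unfolding t_def using norm_triangle_ineq4[of f "clip y r"] norm_clip_le[of r y] f r by linarith
    have "\<bar>e\<bar> \<le> norm t * norm z + b * (norm t)\<^sup>2"
      unfolding e_def using Cauchy_Schwarz_ineq2[of t z] b by (smt (verit) mult_nonneg_nonneg zero_le_power2)
    also have "\<dots> = norm t * (norm z + b * norm t)" by (simp add: power2_eq_square algebra_simps)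
    also have "\<dots> \<le> norm t * q"
      using mult_left_mono[OF t2 b] q(1) by (intro mult_left_mono) auto
    finally have e: "\<bar>e\<bar> \<le> norm t * q" .
    also have "\<dots> \<le> 3 / 2 * r * q" using t2 q0 by (intro mult_right_mono) auto
    also have "\<dots> \<le> 1" using q(2) by (simp add: mult.commute mult.left_commute)
    finally have e1: "\<bar>e\<bar> \<le> 1" .
    have "\<bar>e\<bar>\<^sup>2 \<le> (norm t * q)\<^sup>2" using e by (intro power_mono) auto
    also have "\<dots> \<le> (norm (y - f))\<^sup>2 * q\<^sup>2"
      unfolding power_mult_distrib using t1 by (intro mult_right_mono power_mono) auto
    finally have e2: "e\<^sup>2 \<le> q\<^sup>2 * (norm (y - f))\<^sup>2" by (simp add: mult.commute)
    have "t \<bullet> z = (f - y) \<bullet> z + (y - clip y r) \<bullet> z" by (simp add: t_def inner_diff_left)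
    also have "(y - clip y r) \<bullet> z \<le> norm (y - clip y r) * norm z" by (rule norm_cauchy_schwarz)
    also have "\<dots> \<le> (norm (y - f))\<^sup>2 / (2 * r) * q"
      using clip_residual_le[OF f r, of y] q0 r by (intro mult_mono) auto
    finally have e3: "t \<bullet> z \<le> (f - y) \<bullet> z + q / (2 * r) * (norm (y - f))\<^sup>2"
      by (simp add: mult.commute)
    have e4: "b * (norm t)\<^sup>2 \<le> b * (norm (y - f))\<^sup>2"
      using t1 b by (intro mult_left_mono power_mono) auto
    have "exp e \<le> 1 + e + e\<^sup>2" using e1 by (rule exp_le_quadratic)
    also have "\<dots> \<le> 1 + (f - y) \<bullet> z + C * (norm (y - f))\<^sup>2"
      unfolding C_def distrib_right using e2 e3 e4 unfolding e_def by linarith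
    finally show ?thesis unfolding e_def t_def .
  qed
  have int2: "integrable P (\<lambda>w. (norm (Y w - f))\<^sup>2)"
    using v by (intro integrableI_nonneg) (auto intro: le_less_trans)
  have v': "(LINT w|P. (norm (Y w - f))\<^sup>2) \<le> v"
    using v \<open>0 \<le> v\<close> nn_integral_eq_integral[OF int2] by simp
  have intz: "integrable P (\<lambda>w. (f - Y w) \<bullet> z)" using Y by simp
  have "(\<integral>\<^sup>+ w. ennreal (exp ((f - clip (Y w) r) \<bullet> z + b * (norm (f - clip (Y w) r))\<^sup>2)) \<partial>P)
         \<le> (\<integral>\<^sup>+ w. ennreal (1 + (f - Y w) \<bullet> z + C * (norm (Y w - f))\<^sup>2) \<partial>P)"
    by (intro nn_integral_mono ennreal_leI pw)
  also have "\<dots> = ennreal (LINT w|P. 1 + (f - Y w) \<bullet> z + C * (norm (Y w - f))\<^sup>2)"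
    using int2 intz by (intro nn_integral_eq_integral) (auto intro!: AE_I2 order_trans[OF _ pw])
  also have "(LINT w|P. 1 + (f - Y w) \<bullet> z + C * (norm (Y w - f))\<^sup>2)
     = 1 + C * (LINT w|P. (norm (Y w - f))\<^sup>2)"
    using int2 intz Y EY by (simp add: prob_space)
  also have "\<dots> \<le> 1 + C * v" using v' C0 by (simp add: mult_left_mono)
  also have "\<dots> \<le> exp (C * v)" by (rule exp_ge_add_one_self)
  finally show ?thesis by (simp add: C_def ennreal_leI)
qed

section \<open>Sample means and adapted chains\<close>

text \<open>When one more coordinate is integrated out, its cross term with the remaining sum
  vanishes by centring, so the second moments add up.\<close>

lemma nn_integral_norm_sum_PiM_le:
  fixes Z :: "'s \<Rightarrow> 'a::euclidean_space"
  assumes D: "prob_space D" and [measurable]: "Z \<in> borel_measurable D"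
    and Z: "integrable D Z" "(LINT s|D. Z s) = 0"
    and Z2: "integrable D (\<lambda>s. (norm (Z s))\<^sup>2)" "(LINT s|D. (norm (Z s))\<^sup>2) \<le> v"
    and I: "finite I"
  shows "(\<integral>\<^sup>+ p. ennreal ((norm (\<Sum>i\<in>I. Z (p i)))\<^sup>2) \<partial>PiM I (\<lambda>_. D)) \<le> ennreal (real (card I) * v)"
  using I
proof induction
  case empty
  then show ?case by simp
next
  case (insert i I)
  interpret D: prob_space D by fact
  interpret product_prob_space "\<lambda>_. D" by standard
  interpret PI: prob_space "PiM I (\<lambda>_. D)" by (intro prob_space_PiM D)
  have v0: "0 \<le> v" using Z2(2) by (rule order_trans[rotated]) simp
  have one: "(\<integral>\<^sup>+ s. ennreal ((norm (Z s + a))\<^sup>2) \<partial>D) \<le> ennreal ((norm a)\<^sup>2) + ennreal v" for a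
  proof -
    have eq: "(norm (Z s + a))\<^sup>2 = (norm (Z s))\<^sup>2 + 2 * (Z s \<bullet> a) + (norm a)\<^sup>2" for s
      by (simp only: power2_norm_eq_inner)
         (simp add: inner_add_left inner_add_right inner_commute)
    have int: "integrable D (\<lambda>s. (norm (Z s + a))\<^sup>2)"
      unfolding eq using Z Z2 by simp
    have "(\<integral>\<^sup>+ s. ennreal ((norm (Z s + a))\<^sup>2) \<partial>D) = ennreal (LINT s|D. (norm (Z s + a))\<^sup>2)"
      using int by (intro nn_integral_eq_integral) auto
    also have "(LINT s|D. (norm (Z s + a))\<^sup>2) = (LINT s|D. (norm (Z s))\<^sup>2) + (norm a)\<^sup>2"
      unfolding eq using Z Z2 by (simp add: D.prob_space)
    also have "ennreal \<dots> \<le> ennreal ((norm a)\<^sup>2 + v)" using Z2(2) by (intro ennreal_leI) simp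
    finally show ?thesis using v0 by simp
  qed
  have "(\<integral>\<^sup>+ p. ennreal ((norm (\<Sum>i\<in>insert i I. Z (p i)))\<^sup>2) \<partial>PiM (insert i I) (\<lambda>_. D))
      = (\<integral>\<^sup>+ p. (\<integral>\<^sup>+ s. ennreal ((norm (\<Sum>j\<in>insert i I. Z ((p(i := s)) j)))\<^sup>2) \<partial>D) \<partial>PiM I (\<lambda>_. D))"
    using insert.hyps by (intro product_nn_integral_insert) auto
  also have "\<dots> = (\<integral>\<^sup>+ p. (\<integral>\<^sup>+ s. ennreal ((norm (Z s + (\<Sum>j\<in>I. Z (p j))))\<^sup>2) \<partial>D) \<partial>PiM I (\<lambda>_. D))"
  proof -
    have "(\<Sum>j\<in>insert i I. Z ((p(i := s)) j)) = Z s + (\<Sum>j\<in>I. Z (p j))" for p s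
      using insert.hyps by (auto intro!: sum.cong)
    then show ?thesis by simp
  qed
  also have "\<dots> \<le> (\<integral>\<^sup>+ p. (ennreal ((norm (\<Sum>j\<in>I. Z (p j)))\<^sup>2) + ennreal v) \<partial>PiM I (\<lambda>_. D))"
    by (intro nn_integral_mono one)
  also have "\<dots> = (\<integral>\<^sup>+ p. ennreal ((norm (\<Sum>j\<in>I. Z (p j)))\<^sup>2) \<partial>PiM I (\<lambda>_. D)) + ennreal v"
    by (subst nn_integral_add) (auto simp: PI.emeasure_space_1)
  also have "\<dots> \<le> ennreal (real (card I) * v) + ennreal v"
    by (intro add_right_mono insert.IH)
  also have "\<dots> = ennreal (real (card (insert i I)) * v)"
  proof -
    have "real (card (insert i I)) * v = real (card I) * v + v"
      using insert.hyps by (simp add: algebra_simps)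
    then show ?thesis using v0 by (simp only: ennreal_plus mult_nonneg_nonneg of_nat_0_le_iff)
  qed
  finally show ?case .
qed

text \<open>The index set is arbitrary because a batch will be a set of tagged pairs rather than
  \<open>{1..m}\<close>.\<close>

lemma sample_mean_PiM:
  fixes g :: "'s \<Rightarrow> 'a::euclidean_space"
  assumes D: "prob_space D" and g: "integrable D g" and I: "finite I" "I \<noteq> {}"
    and v: "integrable D (\<lambda>s. (norm (g s - (LINT s|D. g s)))\<^sup>2)"
      "(LINT s|D. (norm (g s - (LINT s|D. g s)))\<^sup>2) \<le> v"
  defines "Y \<equiv> \<lambda>p. (1 / real (card I)) *\<^sub>R (\<Sum>i\<in>I. g (p i))"
  shows "integrable (PiM I (\<lambda>_. D)) Y" (is ?A)
    and "(LINT p|PiM I (\<lambda>_. D). Y p) = (LINT s|D. g s)" (is ?B)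
    and "(\<integral>\<^sup>+ p. ennreal ((norm (Y p - (LINT s|D. g s)))\<^sup>2) \<partial>PiM I (\<lambda>_. D))
           \<le> ennreal (v / real (card I))" (is ?C)
proof -
  interpret D: prob_space D by fact
  interpret product_prob_space "\<lambda>_. D" by standard
  define f where "f = (LINT s|D. g s)"
  have [measurable]: "g \<in> borel_measurable D" using g by auto
  have c: "real (card I) > 0" using I by (simp add: card_gt_0_iff)
  have gi: "integrable (PiM I (\<lambda>_. D)) (\<lambda>p. g (p i))"
    "(LINT p|PiM I (\<lambda>_. D). g (p i)) = f" if "i \<in> I" for i
  proof -
    have d: "distr (PiM I (\<lambda>_. D)) D (\<lambda>p. p i) = D"
      using that by (intro PiM_component)
    have m: "(\<lambda>p. p i) \<in> measurable (PiM I (\<lambda>_. D)) D" using that by simp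
    show "integrable (PiM I (\<lambda>_. D)) (\<lambda>p. g (p i))"
      using integrable_distr[OF m, of g] g by (simp add: d)
    show "(LINT p|PiM I (\<lambda>_. D). g (p i)) = f"
      using integral_distr[OF m, of g] by (simp add: d f_def)
  qed
  show ?A unfolding Y_def using gi by auto
  have "(LINT p|PiM I (\<lambda>_. D). Y p) = (1 / real (card I)) *\<^sub>R (\<Sum>i\<in>I. f)"
    unfolding Y_def using gi by (simp add: integral_sum)
  then show ?B using c unfolding f_def by (simp add: sum_constant_scaleR)
  have eq: "Y p - f = (1 / real (card I)) *\<^sub>R (\<Sum>i\<in>I. (g (p i) - f))" for p
    using c by (simp add: Y_def sum_subtractf sum_constant_scaleR algebra_simps)
  have v0: "0 \<le> v" using v(2) by (rule order_trans[rotated]) simp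
  have "(\<integral>\<^sup>+ p. ennreal ((norm (Y p - f))\<^sup>2) \<partial>PiM I (\<lambda>_. D))
      = (\<integral>\<^sup>+ p. ennreal ((1 / real (card I))\<^sup>2) * ennreal ((norm (\<Sum>i\<in>I. (g (p i) - f)))\<^sup>2) \<partial>PiM I (\<lambda>_. D))"
    unfolding eq by (auto intro!: nn_integral_cong simp: power_mult_distrib power_divide simp flip: ennreal_mult)
  also have "\<dots> = ennreal ((1 / real (card I))\<^sup>2) * (\<integral>\<^sup>+ p. ennreal ((norm (\<Sum>i\<in>I. (g (p i) - f)))\<^sup>2) \<partial>PiM I (\<lambda>_. D))"
    by (intro nn_integral_cmult) auto
  also have "\<dots> \<le> ennreal ((1 / real (card I))\<^sup>2) * ennreal (real (card I) * v)"
    using D I g v by (intro mult_left_mono nn_integral_norm_sum_PiM_le) (auto simp: f_def D.prob_space)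
  also have "\<dots> = ennreal (v / real (card I))"
    using c v0 by (simp add: power2_eq_square flip: ennreal_mult)
  finally show ?C unfolding f_def .
qed

section \<open>Chains driven by independent inputs\<close>

text \<open>An adaptive process as a deterministic function of its inputs: the state at time
  \<open>k\<close> depends on the inputs before \<open>k\<close> only, which takes the place of a
  filtration.\<close>

primrec chain :: "(nat \<Rightarrow> 'p \<Rightarrow> 'st \<Rightarrow> 'st) \<Rightarrow> 'st \<Rightarrow> (nat \<Rightarrow> 'p) \<Rightarrow> nat \<Rightarrow> 'st" where
  "chain T x s 0 = x"
| "chain T x s (Suc k) = T k (s k) (chain T x s k)"

lemma chain_cong: "(\<And>j. j < k \<Longrightarrow> s j = s' j) \<Longrightarrow> chain T x s k = chain T x s' k"
  by (induction k) auto

lemma (in prob_space) measurable_chain: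
  assumes "\<And>k. (\<lambda>(st, p). T k p st) \<in> S \<Otimes>\<^sub>M N k \<rightarrow>\<^sub>M S" and x: "x \<in> space S"
    and Z: "\<And>k. k < n \<Longrightarrow> Z k \<in> M \<rightarrow>\<^sub>M N k"
  shows "(\<lambda>w. chain T x (\<lambda>k. Z k w) n) \<in> M \<rightarrow>\<^sub>M S"
  using Z
proof (induction n)
  case 0
  then show ?case using x by simp
next
  case (Suc n)
  have "(\<lambda>w. (\<lambda>(st, p). T n p st) (chain T x (\<lambda>k. Z k w) n, Z n w)) \<in> M \<rightarrow>\<^sub>M S"
    using Suc by (intro measurable_compose[OF _ assms(1)]) auto
  then show ?case by simp
qed

text \<open>The state at time \<open>n\<close> is a function of the past inputs, hence independent
  of input \<open>n\<close>. Fubini then reduces the expectation to the one-step bound at a fixed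
  state, and induction multiplies the factors.\<close>

lemma (in prob_space) nn_integral_chain_le:
  assumes T: "\<And>k. (\<lambda>(st, p). T k p st) \<in> S \<Otimes>\<^sub>M N k \<rightarrow>\<^sub>M S" and x: "x \<in> space S"
    and Z: "indep_vars N Z (UNIV :: nat set)"
    and f[measurable]: "f \<in> borel_measurable S"
    and step: "\<And>k st. st \<in> space S \<Longrightarrow> (\<integral>\<^sup>+ p. f (T k p st) \<partial>distr M (N k) (Z k)) \<le> C * f st"
  shows "(\<integral>\<^sup>+ w. f (chain T x (\<lambda>k. Z k w) n) \<partial>M) \<le> C ^ n * f x"
proof (induction n)
  case 0
  then show ?case by (simp add: emeasure_space_1)
next
  case (Suc n)
  define A where "A = (\<lambda>w. restrict (\<lambda>i. Z i w) {..<n})"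
  define B where "B = (\<lambda>w. restrict (\<lambda>i. Z i w) {n})"
  have rv[measurable]: "Z k \<in> M \<rightarrow>\<^sub>M N k" for k using Z by (auto simp: indep_vars_def)
  have A[measurable]: "A \<in> M \<rightarrow>\<^sub>M PiM {..<n} N" and B[measurable]: "B \<in> M \<rightarrow>\<^sub>M PiM {n} N"
    unfolding A_def B_def by measurable
  \<comment> \<open>Past and current inputs use disjoint sets of indices, so their joint law is a
    product measure.\<close>
  have "indep_var (PiM {..<n} N) A (PiM {n} N) B"
    unfolding A_def B_def by (rule indep_var_restrict[OF Z]) auto
  then have joint: "distr M (PiM {..<n} N) A \<Otimes>\<^sub>M distr M (PiM {n} N) B
      = distr M (PiM {..<n} N \<Otimes>\<^sub>M PiM {n} N) (\<lambda>w. (A w, B w))"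
    by (simp add: indep_var_distribution_eq)
  interpret DA: prob_space "distr M (PiM {..<n} N) A" by (intro prob_space_distr A)
  interpret DB: prob_space "distr M (PiM {n} N) B" by (intro prob_space_distr B)
  have "(\<lambda>p. chain T x (\<lambda>k. p k) n) \<in> distr M (PiM {..<n} N) A \<rightarrow>\<^sub>M S"
    by (rule DA.measurable_chain[OF T x]) simp
  then have X[measurable]: "(\<lambda>p. chain T x p n) \<in> PiM {..<n} N \<rightarrow>\<^sub>M S" by simp
  note [measurable] = T[of n]
  have XA: "chain T x (\<lambda>k. Z k w) n = chain T x (A w) n" for w
    by (rule chain_cong) (simp add: A_def)
  have g: "(\<lambda>(p, q). f (T n (q n) (chain T x p n)))
      \<in> borel_measurable (PiM {..<n} N \<Otimes>\<^sub>M PiM {n} N)"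
  proof -
    have "(\<lambda>y. f ((\<lambda>(st, p). T n p st) (chain T x (fst y) n, snd y n)))
        \<in> borel_measurable (PiM {..<n} N \<Otimes>\<^sub>M PiM {n} N)"
      by (intro measurable_compose[OF _ f] measurable_compose[OF _ T]) measurable
    then show ?thesis by (simp add: case_prod_unfold)
  qed
  have "(\<integral>\<^sup>+ w. f (chain T x (\<lambda>k. Z k w) (Suc n)) \<partial>M)
      = (\<integral>\<^sup>+ w. (\<lambda>(p, q). f (T n (q n) (chain T x p n))) (A w, B w) \<partial>M)"
    by (simp add: XA B_def)
  also have "\<dots> = (\<integral>\<^sup>+ y. (\<lambda>(p, q). f (T n (q n) (chain T x p n))) y
      \<partial>distr M (PiM {..<n} N \<Otimes>\<^sub>M PiM {n} N) (\<lambda>w. (A w, B w)))"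
    by (subst nn_integral_distr) (use g in auto)
  also have "\<dots> = (\<integral>\<^sup>+ p. (\<integral>\<^sup>+ q. f (T n (q n) (chain T x p n)) \<partial>distr M (PiM {n} N) B)
      \<partial>distr M (PiM {..<n} N) A)"
    unfolding joint[symmetric]
    by (subst DB.nn_integral_fst[symmetric]) (use g in auto)
  also have "\<dots> \<le> (\<integral>\<^sup>+ p. C * f (chain T x p n) \<partial>distr M (PiM {..<n} N) A)"
  proof (rule nn_integral_mono)
    fix p assume "p \<in> space (distr M (PiM {..<n} N) A)"
    then have st: "chain T x p n \<in> space S" using measurable_space[OF X, of p] by simp
    have m: "(\<lambda>q. f (T n q (chain T x p n))) \<in> borel_measurable (N n)"
    proof -
      have "(\<lambda>q. f ((\<lambda>(st, p). T n p st) (chain T x p n, q))) \<in> borel_measurable (N n)"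
        using st by (intro measurable_compose[OF _ f] measurable_compose[OF _ T]) measurable
      then show ?thesis by simp
    qed
    \<comment> \<open>With the past fixed, only the coordinate \<open>n\<close> matters, and its law
      is the one in the one-step bound.\<close>
    have "(\<integral>\<^sup>+ q. f (T n (q n) (chain T x p n)) \<partial>distr M (PiM {n} N) B)
        = (\<integral>\<^sup>+ w. f (T n (Z n w) (chain T x p n)) \<partial>M)"
    proof -
      have "(\<lambda>q. f (T n (q n) (chain T x p n))) \<in> borel_measurable (PiM {n} N)"
        by (rule measurable_compose[OF _ m]) simp
      then show ?thesis by (subst nn_integral_distr[OF B]) (simp_all add: B_def)
    qed
    also have "\<dots> = (\<integral>\<^sup>+ q. f (T n q (chain T x p n)) \<partial>distr M (N n) (Z n))"
      by (rule nn_integral_distr[symmetric]) (use m in auto)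
    also have "\<dots> \<le> C * f (chain T x p n)" by (rule step[OF st])
    finally show "(\<integral>\<^sup>+ q. f (T n (q n) (chain T x p n)) \<partial>distr M (PiM {n} N) B)
        \<le> C * f (chain T x p n)" .
  qed
  also have "\<dots> = C * (\<integral>\<^sup>+ w. f (chain T x (A w) n) \<partial>M)"
    by (subst nn_integral_distr) (auto simp: nn_integral_cmult)
  also have "\<dots> \<le> C * (C ^ n * f x)"
    using Suc.IH unfolding XA by (intro mult_left_mono) auto
  finally show ?case by (simp add: mult.assoc)
qed

section \<open>The stopped process\<close>

lemma minibatch_cong:
  "(\<And>i. i \<in> {1..m} \<Longrightarrow> s i = s' i) \<Longrightarrow> minibatch G m s x = minibatch G m s' x"
  unfolding minibatch_def by (auto intro!: sum.cong)

lemma borel_measurable_clip [measurable (raw)]: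
  fixes f :: "'w \<Rightarrow> 'a::{real_normed_vector, second_countable_topology}"
  assumes [measurable]: "f \<in> borel_measurable N"
  shows "(\<lambda>w. clip (f w) r) \<in> borel_measurable N"
  unfolding clip_def by measurable

section \<open>One extragradient step\<close>

lemma norm_add3_power2_le:
  fixes a b c :: real
  shows "(a + b + c)\<^sup>2 \<le> 3 * (a\<^sup>2 + b\<^sup>2 + c\<^sup>2)"
proof -
  have "0 \<le> (a - b)\<^sup>2 + (b - c)\<^sup>2 + (a - c)\<^sup>2" by simp
  also have "\<dots> = 3 * (a\<^sup>2 + b\<^sup>2 + c\<^sup>2) - (a + b + c)\<^sup>2"
    by (simp add: power2_eq_square algebra_simps)
  finally show ?thesis by simp
qed

text \<open>Here \<open>x - g1\<close> and \<open>x - g2\<close> are the extrapolated and the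
  updated point, \<open>a\<close> and \<open>b\<close> the exact directions at \<open>x\<close> and
  \<open>x - g1\<close>. Expanding leaves the excess
  \<open>(norm (g2 - g1))\<^sup>2 - (norm g1)\<^sup>2\<close>. Splitting \<open>g2 - g1\<close> into
  \<open>b - a\<close> and the two estimation errors, the Lipschitz part is absorbed by
  \<open>- (norm g1)\<^sup>2\<close>.\<close>

lemma extragradient_step_le:
  fixes x u g1 g2 a b :: "'a::real_inner"
  assumes Lip: "norm (b - a) \<le> c * norm g1" and c: "3 * c\<^sup>2 \<le> 1"
  shows "(norm (x - g2 - u))\<^sup>2 \<le> (norm (x - u))\<^sup>2 - 2 * (b \<bullet> (x - g1 - u))
           + 2 * ((b - g2) \<bullet> (x - g1 - u)) + 3 * (norm (b - g2))\<^sup>2 + 3 * (norm (a - g1))\<^sup>2"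
proof -
  have "norm (g2 - g1) \<le> norm (b - a) + norm (b - g2) + norm (a - g1)"
  proof -
    have "g2 - g1 = (b - a) - (b - g2) + (a - g1)" by simp
    then show ?thesis by (metis norm_triangle_le norm_triangle_ineq4 add_right_mono order_refl)
  qed
  then have "norm (g2 - g1) \<le> c * norm g1 + norm (b - g2) + norm (a - g1)"
    using Lip by linarith
  then have "(norm (g2 - g1))\<^sup>2 \<le> (c * norm g1 + norm (b - g2) + norm (a - g1))\<^sup>2"
    by (intro power_mono) auto
  also have "\<dots> \<le> 3 * ((c * norm g1)\<^sup>2 + (norm (b - g2))\<^sup>2 + (norm (a - g1))\<^sup>2)"
    by (rule norm_add3_power2_le)
  also have "\<dots> = 3 * c\<^sup>2 * (norm g1)\<^sup>2 + 3 * (norm (b - g2))\<^sup>2 + 3 * (norm (a - g1))\<^sup>2"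
    by (simp add: power_mult_distrib algebra_simps)
  also have "\<dots> \<le> (norm g1)\<^sup>2 + 3 * (norm (b - g2))\<^sup>2 + 3 * (norm (a - g1))\<^sup>2"
    using mult_right_mono[OF c, of "(norm g1)\<^sup>2"] by simp
  finally have *: "(norm (g2 - g1))\<^sup>2 - (norm g1)\<^sup>2 \<le> 3 * (norm (b - g2))\<^sup>2 + 3 * (norm (a - g1))\<^sup>2"
    by simp
  have "(norm (x - g2 - u))\<^sup>2 = (norm (x - u))\<^sup>2 - 2 * (b \<bullet> (x - g1 - u))
      + 2 * ((b - g2) \<bullet> (x - g1 - u)) + ((norm (g2 - g1))\<^sup>2 - (norm g1)\<^sup>2)"
    by (simp only: power2_norm_eq_inner)
       (simp add: inner_diff_left inner_diff_right inner_commute)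
  then show ?thesis using * by linarith
qed

section \<open>Setting and stopped process\<close>

text \<open>\<open>Inl (k, i)\<close> labels an extrapolation sample of iteration \<open>k\<close>,
  \<open>Inr (k, i)\<close> an update sample. With a single index type, independence of all samples
  is one statement.\<close>

type_synonym index = "nat \<times> nat + nat \<times> nat"

text \<open>Here \<open>l\<close> stands for the logarithmic factor, and the last assumptions are
  the conditions (a) and (b). The space carrying the samples is not fixed, since most of the
  argument concerns single sample paths or the product law of one batch.\<close>

locale clipped_seg =
  fixes D :: "'s measure" and G :: "'s \<Rightarrow> 'a::euclidean_space \<Rightarrow> 'a" and F :: "'a \<Rightarrow> 'a"
    and xstar :: 'a and R L \<sigma> l \<gamma> :: real and m K :: nat
  assumes D: "prob_space D"
    and G_meas: "(\<lambda>(s, x). G s x) \<in> borel_measurable (D \<Otimes>\<^sub>M borel)"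
    and G_int: "\<And>x. integrable D (\<lambda>s. G s x)"
    and F_eq: "\<And>x. F x = (LINT s|D. G s x)"
    and F_xstar: "F xstar = 0"
    and R_pos: "0 < R" and L_pos: "0 < L"
    and var_int: "\<And>x. x \<in> cball xstar (4 * R) \<Longrightarrow> integrable D (\<lambda>s. (norm (G s x - F x))\<^sup>2)"
    and var_le: "\<And>x. x \<in> cball xstar (4 * R) \<Longrightarrow> (LINT s|D. (norm (G s x - F x))\<^sup>2) \<le> \<sigma>\<^sup>2"
    and Lipschitz: "\<And>x y. x \<in> cball xstar (4 * R) \<Longrightarrow> y \<in> cball xstar (4 * R) \<Longrightarrow>
           norm (F x - F y) \<le> L * norm (x - y)"
    and monotone: "\<And>x y. x \<in> cball xstar (4 * R) \<Longrightarrow> y \<in> cball xstar (4 * R) \<Longrightarrow>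
           (F x - F y) \<bullet> (x - y) \<ge> 0"
    and l_ge: "1 \<le> l" and \<gamma>_pos: "0 < \<gamma>" and \<gamma>_le: "\<gamma> \<le> 1 / (160 * L * l)"
    and m_ge: "1 \<le> m" and m_ge': "10800 * (real K + 1) * \<gamma>\<^sup>2 * \<sigma>\<^sup>2 * l / R\<^sup>2 \<le> real m"
begin

definition lam :: real where "lam = R / (20 * \<gamma> * l)"

definition extrapolate :: "nat \<Rightarrow> (index \<Rightarrow> 's) \<Rightarrow> 'a \<Rightarrow> 'a" where
  "extrapolate k p x = x - \<gamma> *\<^sub>R clip (minibatch G m (\<lambda>i. p (Inl (k, i))) x) lam"

definition update :: "nat \<Rightarrow> (index \<Rightarrow> 's) \<Rightarrow> 'a \<Rightarrow> 'a" where
  "update k p x = x - \<gamma> *\<^sub>R clip (minibatch G m (\<lambda>i. p (Inr (k, i))) (extrapolate k p x)) lam"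

definition error1 :: "nat \<Rightarrow> (index \<Rightarrow> 's) \<Rightarrow> 'a \<Rightarrow> 'a" where
  "error1 k p x = \<gamma> *\<^sub>R (F x - clip (minibatch G m (\<lambda>i. p (Inl (k, i))) x) lam)"

definition error2 :: "nat \<Rightarrow> (index \<Rightarrow> 's) \<Rightarrow> 'a \<Rightarrow> 'a" where
  "error2 k p x = \<gamma> *\<^sub>R (F (extrapolate k p x)
     - clip (minibatch G m (\<lambda>i. p (Inr (k, i))) (extrapolate k p x)) lam)"

text \<open>The product with \<open>S\<close> and one of the four squares of \<open>error2\<close>
  come from expanding the square of the new running sum; the coefficients 3 are the remainder in
  \<open>extragradient_step_le\<close>.\<close>

definition increment :: "nat \<Rightarrow> (index \<Rightarrow> 's) \<Rightarrow> 'a \<Rightarrow> 'a \<Rightarrow> real" where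
  "increment k p x S = 2 * (error2 k p x \<bullet> (extrapolate k p x - xstar + S))
     + 4 * (norm (error2 k p x))\<^sup>2 + 3 * (norm (error1 k p x))\<^sup>2"

text \<open>States are triples \<open>(x, S, V)\<close> as in the header.\<close>

definition good :: "'a \<times> 'a \<times> real \<Rightarrow> bool" where
  "good st \<longleftrightarrow> norm (fst st - xstar) \<le> 2 * R \<and> norm (fst (snd st)) \<le> 2 * R"

text \<open>Freezing at bad states keeps the increments bounded on the whole sample space, so the
  one-step moment bound holds at every state.\<close>

definition step :: "nat \<Rightarrow> (index \<Rightarrow> 's) \<Rightarrow> 'a \<times> 'a \<times> real \<Rightarrow> 'a \<times> 'a \<times> real" where
  "step k p st = (if good st then
     (update k p (fst st), fst (snd st) + error2 k p (fst st),
      snd (snd st) + increment k p (fst st) (fst (snd st))) else st)"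

text \<open>\<open>V\<close> is centred at \<open>xstar\<close> while the comparison point
  \<open>u\<close> varies; the last term carries the discrepancy. Thus one random quantity
  \<open>V\<close> serves all \<open>u\<close> in the ball at once.\<close>

definition energy :: "'a \<Rightarrow> 'a \<times> 'a \<times> real \<Rightarrow> real" where
  "energy u st = (norm (fst st - u))\<^sup>2 + (norm (fst (snd st)))\<^sup>2 - snd (snd st)
     + 2 * (fst (snd st) \<bullet> (u - xstar))"

section \<open>Bounds along one sample path\<close>

lemma lam_pos: "0 < lam" and \<gamma>_lam: "\<gamma> * lam = R / (20 * l)" and \<gamma>_lam_le: "\<gamma> * lam \<le> R / 20"
proof -
  show "0 < lam" unfolding lam_def using R_pos \<gamma>_pos l_ge by simp
  show "\<gamma> * lam = R / (20 * l)" unfolding lam_def using \<gamma>_pos by simp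
  moreover have "R / (20 * l) \<le> R / 20" using R_pos l_ge by (intro frac_le) auto
  ultimately show "\<gamma> * lam \<le> R / 20" by simp
qed

lemma L_\<gamma>_le: "L * \<gamma> \<le> 1 / (160 * l)"
  using \<gamma>_le L_pos l_ge by (simp add: field_simps)

lemma extrapolate_near: "norm (extrapolate k p x - x) \<le> R / 20"
proof -
  have "norm (extrapolate k p x - x) = \<gamma> * norm (clip (minibatch G m (\<lambda>i. p (Inl (k, i))) x) lam)"
    using \<gamma>_pos by (simp add: extrapolate_def)
  also have "\<dots> \<le> \<gamma> * lam" using \<gamma>_pos lam_pos by (intro mult_left_mono norm_clip_le) auto
  finally show ?thesis using \<gamma>_lam_le by linarith
qed

lemma extrapolate_bound:
  "norm (x - xstar) \<le> 2 * R \<Longrightarrow> norm (extrapolate k p x - xstar) \<le> 41 / 20 * R"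
  using extrapolate_near[of k p x] norm_triangle_ineq[of "extrapolate k p x - x" "x - xstar"] by simp

text \<open>As \<open>F xstar = 0\<close>, the Lipschitz bound gives \<open>3 * L * R\<close>, and
  the stepsize condition puts this below \<open>lam / 2\<close> because
  \<open>3 / 160 \<le> 1 / 40\<close>. This is the margin that \<open>clip_exp_moment\<close> asks
  for.\<close>

lemma norm_F_le:
  assumes "norm (x - xstar) \<le> 3 * R"
  shows "norm (F x) \<le> lam / 2"
proof -
  have "norm (F x) \<le> L * norm (x - xstar)"
    using Lipschitz[of x xstar] assms R_pos
    by (simp add: F_xstar dist_norm norm_minus_commute)
  also have "\<dots> \<le> L * (3 * R)" using assms L_pos by (intro mult_left_mono) auto
  finally have "\<gamma> * norm (F x) \<le> L * \<gamma> * (3 * R)"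
    using mult_left_mono[of "norm (F x)" "L * (3 * R)" \<gamma>] \<gamma>_pos by (simp add: ac_simps)
  also have "\<dots> \<le> 1 / (160 * l) * (3 * R)" using L_\<gamma>_le R_pos by (intro mult_right_mono) auto
  also have "\<dots> \<le> \<gamma> * (lam / 2)" using \<gamma>_lam R_pos l_ge by (simp add: field_simps)
  finally show ?thesis using \<gamma>_pos by simp
qed

text \<open>\<open>extragradient_step_le\<close> is applied to the directions scaled by
  \<open>\<gamma>\<close>; monotonicity replaces \<open>F\<close> at the extrapolated point by
  \<open>F u\<close>, and \<open>V\<close> and \<open>S\<close> absorb the noise.\<close>

lemma energy_step:
  assumes "good st" and u: "norm (u - xstar) \<le> R"
  shows "energy u (step k p st) + 2 * \<gamma> * (F u \<bullet> (extrapolate k p (fst st) - u)) \<le> energy u st"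
proof -
  obtain x S V where st: "st = (x, S, V)" by (cases st) auto
  define xt where "xt = extrapolate k p x"
  define e1 where "e1 = clip (minibatch G m (\<lambda>i. p (Inl (k, i))) x) lam"
  define e2 where "e2 = clip (minibatch G m (\<lambda>i. p (Inr (k, i))) xt) lam"
  have x: "norm (x - xstar) \<le> 2 * R" using assms(1) by (simp add: good_def st)
  have xt: "xt = x - \<gamma> *\<^sub>R e1" by (simp add: xt_def e1_def extrapolate_def)
  have xtb: "norm (xt - xstar) \<le> 41 / 20 * R" unfolding xt_def using x by (rule extrapolate_bound)
  have mem: "x \<in> cball xstar (4 * R)" "xt \<in> cball xstar (4 * R)" "u \<in> cball xstar (4 * R)"
    using x xtb u R_pos by (auto simp: dist_norm norm_minus_commute)
  have "norm (\<gamma> *\<^sub>R F xt - \<gamma> *\<^sub>R F x) = \<gamma> * norm (F xt - F x)"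
    using \<gamma>_pos by (simp flip: scaleR_diff_right)
  also have "\<dots> \<le> \<gamma> * (L * norm (xt - x))"
    using Lipschitz[OF mem(2,1)] \<gamma>_pos by (intro mult_left_mono) auto
  also have "\<dots> = (L * \<gamma>) * norm (\<gamma> *\<^sub>R e1)" by (simp add: xt)
  finally have Lip: "norm (\<gamma> *\<^sub>R F xt - \<gamma> *\<^sub>R F x) \<le> (L * \<gamma>) * norm (\<gamma> *\<^sub>R e1)" .
  have "1 / (160 * l) \<le> 1 / 160" using l_ge by (intro frac_le) auto
  then have "L * \<gamma> \<le> 1 / 160" using L_\<gamma>_le by linarith
  then have "(L * \<gamma>)\<^sup>2 \<le> (1 / 160)\<^sup>2" using L_pos \<gamma>_pos by (intro power_mono) auto
  then have c: "3 * (L * \<gamma>)\<^sup>2 \<le> 1" by (simp add: power2_eq_square)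
  note * = extragradient_step_le[OF Lip c, of x "\<gamma> *\<^sub>R e2" u, folded xt]
  have mono: "F u \<bullet> (xt - u) \<le> F xt \<bullet> (xt - u)"
    using monotone[OF mem(2,3)] by (simp add: inner_diff_left)
  have mono': "2 * \<gamma> * (F u \<bullet> (xt - u)) \<le> 2 * (\<gamma> *\<^sub>R F xt \<bullet> (xt - u))"
    using mult_left_mono[OF mono, of \<gamma>] \<gamma>_pos by simp
  define t where "t = \<gamma> *\<^sub>R F xt - \<gamma> *\<^sub>R e2"
  define o1 where "o1 = \<gamma> *\<^sub>R F x - \<gamma> *\<^sub>R e1"
  have new: "step k p (x, S, V) = (x - \<gamma> *\<^sub>R e2, S + t,
      V + (2 * (t \<bullet> (xt - xstar + S)) + 4 * (norm t)\<^sup>2 + 3 * (norm o1)\<^sup>2))"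
    using assms(1)
    by (simp add: step_def st update_def error2_def error1_def increment_def xt_def e1_def e2_def
        t_def o1_def scaleR_diff_right)
  \<comment> \<open>All products with \<open>S\<close> cancel, and the shift by
    \<open>u - xstar\<close> turns \<open>xt - xstar\<close> into \<open>xt - u\<close>.\<close>
  have "energy u (step k p st) - energy u st
      = (norm (x - \<gamma> *\<^sub>R e2 - u))\<^sup>2 - (norm (x - u))\<^sup>2 - 2 * (t \<bullet> (xt - u))
        - 3 * (norm t)\<^sup>2 - 3 * (norm o1)\<^sup>2"
    unfolding st new energy_def fst_conv snd_conv
    by (simp only: power2_norm_eq_inner)
       (simp add: inner_add_left inner_add_right inner_diff_left inner_diff_right inner_commute)
  then show ?thesis
    using * mono' unfolding t_def o1_def xt_def[symmetric] st fst_conv by linarith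
qed

text \<open>At \<open>u = xstar\<close> the energy never increases, so the bound on the final
  \<open>V\<close> makes the final state good. Freezing is permanent, hence all earlier states were
  good as well, and \<open>energy_step\<close> telescopes for every \<open>u\<close>.\<close>

lemma chain_deterministic:
  fixes q :: "index \<Rightarrow> 's"
  assumes x0: "norm (x0 - xstar) \<le> R"
  defines "st \<equiv> chain step (x0, 0, 0) (\<lambda>_. q)"
  assumes V: "snd (snd (st n)) \<le> 3 * R\<^sup>2"
  shows "\<forall>k\<le>n. good (st k)"
    and "norm (u - xstar) \<le> R \<Longrightarrow>
      2 * \<gamma> * (\<Sum>k<n. F u \<bullet> (extrapolate k q (fst (st k)) - u)) \<le> 9 * R\<^sup>2"
proof -
  have st_0: "st 0 = (x0, 0, 0)" and st_Suc: "st (Suc k) = step k q (st k)" for k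
    by (simp_all add: st_def)
  have inv: "energy xstar (st k) \<le> R\<^sup>2" for k
  proof (induction k)
    case 0
    then show ?case using x0 by (simp add: st_0 energy_def power_mono)
  next
    case (Suc k)
    show ?case
    proof (cases "good (st k)")
      case True
      then show ?thesis using energy_step[OF True, of xstar k q] Suc R_pos by (simp add: F_xstar st_Suc)
    qed (use Suc in \<open>simp add: st_Suc step_def\<close>)
  qed
  have good_n: "good (st n)"
  proof -
    have "(norm (fst (st n) - xstar))\<^sup>2 + (norm (fst (snd (st n))))\<^sup>2 \<le> (2 * R)\<^sup>2"
      using inv[of n] V by (simp add: energy_def power_mult_distrib)
    then have "(norm (fst (st n) - xstar))\<^sup>2 \<le> (2 * R)\<^sup>2" "(norm (fst (snd (st n))))\<^sup>2 \<le> (2 * R)\<^sup>2"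
      using zero_le_power2[of "norm (fst (st n) - xstar)"] zero_le_power2[of "norm (fst (snd (st n)))"]
      by linarith+
    then show ?thesis using R_pos by (auto simp: good_def intro: power2_le_imp_le)
  qed
  have "good (st k)" if "k \<le> n" for k
    using that good_n
  proof (induction k rule: inc_induct)
    case (step k)
    then show ?case by (cases "good (st k)") (auto simp: st_Suc step_def)
  qed
  then show good: "\<forall>k\<le>n. good (st k)" by blast
  assume u: "norm (u - xstar) \<le> R"
  have "energy u (st k) + 2 * \<gamma> * (\<Sum>j<k. F u \<bullet> (extrapolate j q (fst (st j)) - u)) \<le> energy u (st 0)"
    if "k \<le> n" for k
    using that
  proof (induction k)
    case (Suc k)
    then have "good (st k)" using good by simp
    from energy_step[OF this u, of k q] Suc show ?case by (simp add: st_Suc algebra_simps)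
  qed simp
  then have "2 * \<gamma> * (\<Sum>j<n. F u \<bullet> (extrapolate j q (fst (st j)) - u)) \<le> energy u (st 0) - energy u (st n)"
    by fastforce
  moreover have "energy u (st 0) \<le> 4 * R\<^sup>2"
  proof -
    have "norm (x0 - u) \<le> 2 * R"
      using x0 u norm_triangle_ineq4[of "x0 - xstar" "u - xstar"] by simp
    then have "(norm (x0 - u))\<^sup>2 \<le> (2 * R)\<^sup>2" by (intro power_mono) auto
    then show ?thesis by (simp add: energy_def st_0)
  qed
  moreover have "- energy u (st n) \<le> 4 * R\<^sup>2"
  proof -
    define S where "S = fst (snd (st n))"
    \<comment> \<open>Completing the square costs only \<open>R\<^sup>2\<close>, uniformly in
      \<open>u\<close>; this is why the energy contains the square of \<open>S\<close>.\<close>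
    have "0 \<le> (norm (S + (u - xstar)))\<^sup>2" by simp
    also have "\<dots> = (norm S)\<^sup>2 + 2 * (S \<bullet> (u - xstar)) + (norm (u - xstar))\<^sup>2"
      by (simp only: power2_norm_eq_inner) (simp add: inner_add_left inner_add_right inner_commute)
    finally have "- ((norm S)\<^sup>2 + 2 * (S \<bullet> (u - xstar))) \<le> R\<^sup>2"
      using power_mono[OF u, of 2] by simp
    then show ?thesis using V zero_le_power2[of "norm (fst (st n) - u)"]
      unfolding energy_def S_def[symmetric] by linarith
  qed
  \<comment> \<open>The two bounds add up to \<open>8 * R\<^sup>2\<close>. The constant 9 is the one
    behind \<open>720 = 9 * 160 / 2\<close> and \<open>270 = 9 * 60 / 2\<close>.\<close>
  ultimately show "2 * \<gamma> * (\<Sum>k<n. F u \<bullet> (extrapolate k q (fst (st k)) - u)) \<le> 9 * R\<^sup>2"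
    using zero_le_power2[of R] by linarith
qed

section \<open>Measurability of the transition\<close>

text \<open>Regularity of \<open>F\<close> is assumed only on a ball, while the transition has to be
  measurable at all states; so measurability is taken from the integral representation.\<close>

lemma F_measurable [measurable]: "F \<in> borel_measurable borel"
proof -
  interpret D: prob_space D by (rule D)
  have "(\<lambda>(x, s). G s x) \<in> borel_measurable (borel \<Otimes>\<^sub>M D)"
    using measurable_compose[OF measurable_pair_swap' G_meas] by (simp add: case_prod_unfold)
  then have "(\<lambda>x. LINT s|D. G s x) \<in> borel_measurable borel"
    by (rule D.borel_measurable_lebesgue_integral)
  then show ?thesis by (simp add: F_eq[abs_def])
qed

lemma measurable_minibatch:
  assumes [measurable]: "x \<in> borel_measurable N" and s: "\<And>i. i \<in> {1..m} \<Longrightarrow> (\<lambda>y. s y i) \<in> N \<rightarrow>\<^sub>M D"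
  shows "(\<lambda>y. minibatch G m (s y) (x y)) \<in> borel_measurable N"
proof -
  have "(\<lambda>y. G (s y i) (x y)) \<in> borel_measurable N" if "i \<in> {1..m}" for i
  proof -
    note [measurable] = s[OF that]
    have "(\<lambda>y. (\<lambda>(s, x). G s x) (s y i, x y)) \<in> borel_measurable N"
      by (intro measurable_compose[OF _ G_meas]) measurable
    then show ?thesis by simp
  qed
  then show ?thesis unfolding minibatch_def
    by (intro borel_measurable_scaleR borel_measurable_const borel_measurable_sum) auto
qed

abbreviation batch1 :: "nat \<Rightarrow> index set" where "batch1 k \<equiv> (\<lambda>i. Inl (k, i)) ` {1..m}"
abbreviation batch2 :: "nat \<Rightarrow> index set" where "batch2 k \<equiv> (\<lambda>i. Inr (k, i)) ` {1..m}"
abbreviation block :: "nat \<Rightarrow> index set" where "block k \<equiv> batch1 k \<union> batch2 k"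

text \<open>Iteration \<open>k\<close> reads only its own block. Hence different iterations have
  independent inputs, and a full sample table may replace the blocks.\<close>

lemma step_cong:
  assumes "\<And>i. i \<in> block k \<Longrightarrow> p i = q i"
  shows "step k p st = step k q st"
proof -
  have "minibatch G m (\<lambda>i. p (Inl (k, i))) x = minibatch G m (\<lambda>i. q (Inl (k, i))) x"
    "minibatch G m (\<lambda>i. p (Inr (k, i))) x = minibatch G m (\<lambda>i. q (Inr (k, i))) x" for x
    using assms by (auto intro!: minibatch_cong)
  then show ?thesis
    by (simp add: step_def update_def error2_def error1_def increment_def extrapolate_def)
qed

lemma measurable_step: "(\<lambda>(st, p). step k p st) \<in> borel \<Otimes>\<^sub>M PiM (block k) (\<lambda>_. D) \<rightarrow>\<^sub>M borel"
proof -
  define B where "B = (borel :: ('a \<times> 'a \<times> real) measure) \<Otimes>\<^sub>M PiM (block k) (\<lambda>_. D)"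
  have *: "(\<lambda>y. fst (fst y)) \<in> borel_measurable B" "(\<lambda>y. fst (snd (fst y))) \<in> borel_measurable B"
    "(\<lambda>y. snd (snd (fst y))) \<in> borel_measurable B" "fst \<in> borel_measurable B"
    unfolding B_def borel_prod[symmetric] by measurable
  note [measurable] = *
  have s: "(\<lambda>y. snd y (Inl (k, i))) \<in> B \<rightarrow>\<^sub>M D" "(\<lambda>y. snd y (Inr (k, i))) \<in> B \<rightarrow>\<^sub>M D" if "i \<in> {1..m}" for i
    using that unfolding B_def
    by (auto intro!: measurable_compose[OF measurable_snd measurable_component_singleton])
  have [measurable]: "(\<lambda>y. minibatch G m (\<lambda>i. snd y (Inl (k, i))) (fst (fst y))) \<in> borel_measurable B"
    using s by (intro measurable_minibatch *) auto
  have ex[measurable]: "(\<lambda>y. extrapolate k (snd y) (fst (fst y))) \<in> borel_measurable B"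
    unfolding extrapolate_def by measurable
  have [measurable]: "(\<lambda>y. minibatch G m (\<lambda>i. snd y (Inr (k, i))) (extrapolate k (snd y) (fst (fst y))))
      \<in> borel_measurable B"
    using s by (intro measurable_minibatch ex) auto
  have "(\<lambda>y. step k (snd y) (fst y)) \<in> borel_measurable B"
    unfolding step_def good_def update_def error1_def error2_def increment_def
    by (intro measurable_If borel_measurable_Pair) measurable
  then show ?thesis by (simp add: B_def case_prod_unfold)
qed

section \<open>Exponential moment of one iteration\<close>

text \<open>Serves both batches of an iteration, \<open>c\<close> being the tagging of the samples.
  By the batch condition, each batch uses at most half of the budget \<open>l / (real K + 1)\<close>
  of an iteration.\<close>

lemma exp_moment_minibatch:
  fixes c :: "nat \<Rightarrow> index"
  assumes c: "inj c" and x: "norm (x - xstar) \<le> 3 * R"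
    and z: "norm z \<le> 10 * l * \<gamma> / R" and b: "0 \<le> b" "b \<le> 4 * l * \<gamma>\<^sup>2 / R\<^sup>2"
  defines "t \<equiv> \<lambda>p. F x - clip (minibatch G m (\<lambda>i. p (c i)) x) lam"
  shows "(\<integral>\<^sup>+ p. ennreal (exp (t p \<bullet> z + b * (norm (t p))\<^sup>2)) \<partial>PiM (c ` {1..m}) (\<lambda>_. D))
           \<le> ennreal (exp (l / (2 * (real K + 1))))"
proof -
  have xm: "x \<in> cball xstar (4 * R)" using x R_pos by (auto simp: dist_norm norm_minus_commute)
  have inj: "inj_on c {1..m}" using c by (rule inj_on_subset) simp
  have card: "card (c ` {1..m}) = m" using card_image[OF inj] by simp
  have mb: "minibatch G m (\<lambda>i. p (c i)) x
      = (1 / real (card (c ` {1..m}))) *\<^sub>R (\<Sum>i\<in>c ` {1..m}. G (p i) x)" for p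
    unfolding minibatch_def card by (simp only: sum.reindex[OF inj] o_def)
  note mean = sample_mean_PiM[OF D G_int[of x], of "c ` {1..m}" "\<sigma>\<^sup>2", folded mb F_eq, unfolded card]
  \<comment> \<open>10 parts cover \<open>norm z\<close> and the last one
    \<open>3 / 2 * b * lam \<le> 3 / 10 * \<gamma> / R\<close>; then
    \<open>3 / 2 * q * lam = 33 / 40\<close>.\<close>
  define q where "q = 11 * l * \<gamma> / R"
  define A where "A = (l * \<gamma> / R)\<^sup>2"
  have lg: "0 < l * \<gamma> / R" using l_ge \<gamma>_pos R_pos by simp
  have l2: "l * \<gamma>\<^sup>2 / R\<^sup>2 \<le> A"
    using mult_right_mono[of l "l\<^sup>2" "\<gamma>\<^sup>2 / R\<^sup>2"] l_ge
    by (simp add: A_def power_mult_distrib power_divide self_le_power)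
  have bl: "3 / 2 * b * lam \<le> l * \<gamma> / R"
  proof -
    define w where "w = l * \<gamma> / R"
    have "b * lam \<le> 4 * l * \<gamma>\<^sup>2 / R\<^sup>2 * lam" using b lam_pos by (intro mult_right_mono) auto
    also have "\<dots> = \<gamma> / (5 * R)"
      using l_ge \<gamma>_pos R_pos unfolding lam_def by (simp add: power2_eq_square)
    also have "\<dots> \<le> l * \<gamma> / R / 5" using l_ge \<gamma>_pos R_pos by (simp add: field_simps)
    finally have "3 / 2 * (b * lam) \<le> w" using lg unfolding w_def[symmetric] by linarith
    then show ?thesis by (simp only: mult.assoc w_def)
  qed
  have q1: "norm z + 3 / 2 * b * lam \<le> q"
  proof -
    have "q = 10 * l * \<gamma> / R + l * \<gamma> / R" unfolding q_def by (simp flip: add_divide_distrib)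
    then show ?thesis using add_mono[OF z bl] by simp
  qed
  have q2: "3 / 2 * q * lam \<le> 1"
    using l_ge \<gamma>_pos R_pos unfolding q_def lam_def by simp
  have "(\<integral>\<^sup>+ p. ennreal (exp (t p \<bullet> z + b * (norm (t p))\<^sup>2)) \<partial>PiM (c ` {1..m}) (\<lambda>_. D))
      \<le> ennreal (exp ((q / (2 * lam) + b + q\<^sup>2) * (\<sigma>\<^sup>2 / real m)))"
    unfolding t_def
  proof (rule clip_exp_moment)
    show "prob_space (PiM (c ` {1..m}) (\<lambda>_. D))" by (intro prob_space_PiM D)
    show "norm (F x) \<le> lam / 2" using x by (rule norm_F_le)
  qed (use mean var_int[OF xm] var_le[OF xm] m_ge lam_pos b q1 q2 in \<open>auto simp: F_eq\<close>)
  also have "\<dots> \<le> ennreal (exp (l / (2 * (real K + 1))))"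
  proof (intro ennreal_leI, subst exp_le_cancel_iff)
    \<comment> \<open>The coefficient of the variance is at most \<open>110 + 4 + 121 = 235\<close>
      times \<open>A\<close>, and \<open>235 / 10800 \<le> 1 / 2\<close>.\<close>
    have "q / (2 * lam) = 110 * A"
      using l_ge \<gamma>_pos R_pos unfolding q_def lam_def A_def by (simp add: power2_eq_square)
    moreover have "b \<le> 4 * A" using b(2) l2 by simp
    moreover have "q\<^sup>2 = 121 * A" unfolding q_def A_def by (simp add: power_mult_distrib power_divide)
    ultimately have "q / (2 * lam) + b + q\<^sup>2 \<le> 235 * A" by linarith
    then have "(q / (2 * lam) + b + q\<^sup>2) * (\<sigma>\<^sup>2 / real m) \<le> 235 * A * (\<sigma>\<^sup>2 / real m)"
      by (intro mult_right_mono) auto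
    also have "A * (\<sigma>\<^sup>2 / real m) \<le> l / (10800 * (real K + 1))"
    proof -
      have "10800 * (real K + 1) * (A * \<sigma>\<^sup>2) = l * (10800 * (real K + 1) * \<gamma>\<^sup>2 * \<sigma>\<^sup>2 * l / R\<^sup>2)"
        by (simp add: A_def power_mult_distrib power_divide power2_eq_square)
      also have "\<dots> \<le> l * real m" using m_ge' l_ge by (intro mult_left_mono) auto
      finally show ?thesis using m_ge by (simp add: field_simps)
    qed
    then have "235 * A * (\<sigma>\<^sup>2 / real m) \<le> 235 * (l / (10800 * (real K + 1)))" by simp
    also have "\<dots> \<le> l / (2 * (real K + 1))" using l_ge by (simp add: divide_simps)
    finally show "(q / (2 * lam) + b + q\<^sup>2) * (\<sigma>\<^sup>2 / real m) \<le> l / (2 * (real K + 1))" .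
  qed
  finally show ?thesis .
qed

text \<open>At a frozen state the factor at least 1 suffices. Otherwise the update batch is
  integrated first, with the extrapolation batch and hence the extrapolated point held fixed, and
  the extrapolation batch afterwards.\<close>

lemma step_exp_moment:
  "(\<integral>\<^sup>+ p. ennreal (exp (l / R\<^sup>2 * snd (snd (step k p st)))) \<partial>PiM (block k) (\<lambda>_. D))
     \<le> ennreal (exp (l / (real K + 1))) * ennreal (exp (l / R\<^sup>2 * snd (snd st)))"
proof (cases "good st")
  case False
  interpret P: prob_space "PiM (block k) (\<lambda>_. D)" by (intro prob_space_PiM D)
  have "1 * ennreal (exp (l / R\<^sup>2 * snd (snd st)))
      \<le> ennreal (exp (l / (real K + 1))) * ennreal (exp (l / R\<^sup>2 * snd (snd st)))"
    using l_ge by (intro mult_right_mono) (auto simp: one_le_exp_iff)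
  then show ?thesis using False by (simp add: step_def P.emeasure_space_1[simplified])
next
  case True
  obtain x S V where st: "st = (x, S, V)" by (cases st) auto
  have x: "norm (x - xstar) \<le> 2 * R" and S: "norm S \<le> 2 * R" using True by (auto simp: good_def st)
  interpret DD: prob_space D by (rule D)
  interpret product_prob_space "\<lambda>_. D" by standard
  define xt where "xt p = extrapolate k p x" for p
  define t1 where "t1 p = F x - clip (minibatch G m (\<lambda>i. p (Inl (k, i))) x) lam" for p :: "index \<Rightarrow> 's"
  define t2 where "t2 p p' = F (xt p) - clip (minibatch G m (\<lambda>i. p' (Inr (k, i))) (xt p)) lam" for p p' :: "index \<Rightarrow> 's"
  define z where "z p = (2 * (l / R\<^sup>2) * \<gamma>) *\<^sub>R (xt p - xstar + S)" for p
  define b where "b = 4 * l * \<gamma>\<^sup>2 / R\<^sup>2"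
  define E where "E = ennreal (exp (l / (2 * (real K + 1))))"
  have b0: "0 \<le> b" unfolding b_def using l_ge by simp
  \<comment> \<open>The factor \<open>3 / 4\<close> is the ratio of the coefficients in
    \<open>increment\<close>; the product with 0 gives the first error the shape required by
    \<open>exp_moment_minibatch\<close>.\<close>
  have val: "l / R\<^sup>2 * snd (snd (step k (merge (batch1 k) (batch2 k) (p, p')) st))
      = l / R\<^sup>2 * V + (t1 p \<bullet> 0 + 3 / 4 * b * (norm (t1 p))\<^sup>2) + (t2 p p' \<bullet> z p + b * (norm (t2 p p'))\<^sup>2)"
    for p p'
  proof -
    define r where "r = merge (batch1 k) (batch2 k) (p, p')"
    have m1: "minibatch G m (\<lambda>i. r (Inl (k, i))) y = minibatch G m (\<lambda>i. p (Inl (k, i))) y" for y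
      by (rule minibatch_cong) (auto simp: r_def merge_def)
    have m2: "minibatch G m (\<lambda>i. r (Inr (k, i))) y = minibatch G m (\<lambda>i. p' (Inr (k, i))) y" for y
      by (rule minibatch_cong) (auto simp: r_def merge_def)
    have e: "extrapolate k r x = xt p" by (simp add: extrapolate_def xt_def m1)
    have "snd (snd (step k r st)) = V + (2 * (\<gamma> *\<^sub>R t2 p p' \<bullet> (xt p - xstar + S))
        + 4 * (norm (\<gamma> *\<^sub>R t2 p p'))\<^sup>2 + 3 * (norm (\<gamma> *\<^sub>R t1 p))\<^sup>2)"
      using True by (simp add: step_def increment_def error1_def error2_def st e m1 m2 t1_def t2_def)
    also have "l / R\<^sup>2 * \<dots> = l / R\<^sup>2 * V + (t1 p \<bullet> 0 + 3 / 4 * b * (norm (t1 p))\<^sup>2)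
        + (t2 p p' \<bullet> z p + b * (norm (t2 p p'))\<^sup>2)"
      using \<gamma>_pos by (simp add: z_def b_def power_mult_distrib algebra_simps)
    finally show ?thesis unfolding r_def .
  qed
  have zb: "norm (z p) \<le> 10 * l * \<gamma> / R" for p
  proof -
    have "norm (xt p - xstar + S) \<le> 5 * R"
      using extrapolate_bound[OF x, of k p] norm_triangle_ineq[of "xt p - xstar" S] S R_pos
      unfolding xt_def by linarith
    then have "2 * (l / R\<^sup>2) * \<gamma> * norm (xt p - xstar + S) \<le> 2 * (l / R\<^sup>2) * \<gamma> * (5 * R)"
      using l_ge \<gamma>_pos by (intro mult_left_mono) auto
    moreover have "norm (z p) = 2 * (l / R\<^sup>2) * \<gamma> * norm (xt p - xstar + S)"
      unfolding z_def using l_ge \<gamma>_pos by simp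
    ultimately have "norm (z p) \<le> 2 * (l / R\<^sup>2) * \<gamma> * (5 * R)" by simp
    also have "\<dots> = 10 * l * \<gamma> / R" using R_pos by (simp add: power2_eq_square)
    finally show ?thesis .
  qed
  have inner: "(\<integral>\<^sup>+ p'. ennreal (exp (t2 p p' \<bullet> z p + b * (norm (t2 p p'))\<^sup>2)) \<partial>PiM (batch2 k) (\<lambda>_. D)) \<le> E" for p
    unfolding t2_def E_def
  proof (rule exp_moment_minibatch)
    show "norm (xt p - xstar) \<le> 3 * R"
      using extrapolate_bound[OF x, of k p] R_pos unfolding xt_def by linarith
  qed (use zb b0 in \<open>auto simp: b_def inj_def\<close>)
  have outer: "(\<integral>\<^sup>+ p. ennreal (exp (t1 p \<bullet> 0 + 3 / 4 * b * (norm (t1 p))\<^sup>2)) \<partial>PiM (batch1 k) (\<lambda>_. D)) \<le> E"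
    unfolding t1_def E_def
  proof (rule exp_moment_minibatch)
    have "3 / 4 * b \<le> b" using b0 by simp
    then show "3 / 4 * b \<le> 4 * l * \<gamma>\<^sup>2 / R\<^sup>2" by (simp only: b_def)
  qed (use x R_pos b0 l_ge \<gamma>_pos in \<open>auto simp: inj_def\<close>)
  have m1: "(\<lambda>p. ennreal (exp (t1 p \<bullet> 0 + 3 / 4 * b * (norm (t1 p))\<^sup>2))) \<in> borel_measurable (PiM (batch1 k) (\<lambda>_. D))"
  proof -
    have [measurable]: "(\<lambda>p. minibatch G m (\<lambda>i. p (Inl (k, i))) x) \<in> borel_measurable (PiM (batch1 k) (\<lambda>_. D))"
      by (intro measurable_minibatch) auto
    show ?thesis unfolding t1_def by measurable
  qed
  have m2: "(\<lambda>p'. ennreal (exp (t2 p p' \<bullet> z p + b * (norm (t2 p p'))\<^sup>2))) \<in> borel_measurable (PiM (batch2 k) (\<lambda>_. D))" for p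
  proof -
    have [measurable]: "(\<lambda>p'. minibatch G m (\<lambda>i. p' (Inr (k, i))) (xt p)) \<in> borel_measurable (PiM (batch2 k) (\<lambda>_. D))"
      by (intro measurable_minibatch) auto
    show ?thesis unfolding t2_def by measurable
  qed
  have ms: "(\<lambda>p. ennreal (exp (l / R\<^sup>2 * snd (snd (step k p st))))) \<in> borel_measurable (PiM (block k) (\<lambda>_. D))"
  proof -
    have "(\<lambda>p. (\<lambda>(st, p). step k p st) (st, p)) \<in> PiM (block k) (\<lambda>_. D) \<rightarrow>\<^sub>M borel"
      by (intro measurable_compose[OF _ measurable_step]) measurable
    then have "(\<lambda>p. step k p st) \<in> PiM (block k) (\<lambda>_. D) \<rightarrow>\<^sub>M borel \<Otimes>\<^sub>M borel \<Otimes>\<^sub>M borel"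
      by (simp add: borel_prod)
    then show ?thesis by measurable
  qed
  have "(\<integral>\<^sup>+ p. ennreal (exp (l / R\<^sup>2 * snd (snd (step k p st)))) \<partial>PiM (block k) (\<lambda>_. D))
      = (\<integral>\<^sup>+ p. (\<integral>\<^sup>+ p'. ennreal (exp (l / R\<^sup>2 * snd (snd (step k (merge (batch1 k) (batch2 k) (p, p')) st))))
           \<partial>PiM (batch2 k) (\<lambda>_. D)) \<partial>PiM (batch1 k) (\<lambda>_. D))"
    by (intro product_nn_integral_fold) (use ms in auto)
  also have "\<dots> = (\<integral>\<^sup>+ p. ennreal (exp (l / R\<^sup>2 * V)) * (ennreal (exp (t1 p \<bullet> 0 + 3 / 4 * b * (norm (t1 p))\<^sup>2)) *
        (\<integral>\<^sup>+ p'. ennreal (exp (t2 p p' \<bullet> z p + b * (norm (t2 p p'))\<^sup>2)) \<partial>PiM (batch2 k) (\<lambda>_. D))) \<partial>PiM (batch1 k) (\<lambda>_. D))"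
  proof -
    have "ennreal (exp (a + b + c)) = ennreal (exp a * exp b) * ennreal (exp c)" for a b c :: real
      by (simp add: exp_add ennreal_mult)
    then show ?thesis unfolding val
      by (simp only: nn_integral_cmult[OF m2]) (simp only: ennreal_mult exp_ge_zero mult.assoc)
  qed
  also have "\<dots> \<le> (\<integral>\<^sup>+ p. ennreal (exp (l / R\<^sup>2 * V)) * (ennreal (exp (t1 p \<bullet> 0 + 3 / 4 * b * (norm (t1 p))\<^sup>2)) * E)
        \<partial>PiM (batch1 k) (\<lambda>_. D))"
    by (intro nn_integral_mono mult_left_mono inner) auto
  also have "\<dots> = ennreal (exp (l / R\<^sup>2 * V)) *
      ((\<integral>\<^sup>+ p. ennreal (exp (t1 p \<bullet> 0 + 3 / 4 * b * (norm (t1 p))\<^sup>2)) \<partial>PiM (batch1 k) (\<lambda>_. D)) * E)"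
    using m1 by (subst nn_integral_cmult) (auto simp: nn_integral_multc)
  also have "\<dots> \<le> ennreal (exp (l / R\<^sup>2 * V)) * (E * E)"
    by (intro mult_left_mono mult_right_mono outer) auto
  also have "E * E = ennreal (exp (l / (real K + 1)))"
  proof -
    have "a / (2 * b) + a / (2 * b) = a / b" for a b :: real by (cases "b = 0") (auto simp: field_simps)
    then show ?thesis unfolding E_def by (simp only: exp_ge_zero flip: ennreal_mult exp_add)
  qed
  finally show ?thesis by (simp add: st mult.commute)
qed

section \<open>From the stopped process back to clipped-SEG\<close>

abbreviation iterate :: "(nat \<Rightarrow> nat \<Rightarrow> 's) \<Rightarrow> (nat \<Rightarrow> nat \<Rightarrow> 's) \<Rightarrow> 'a \<Rightarrow> nat \<Rightarrow> 'a" where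
  "iterate s1 s2 x0 \<equiv> seg_iterate G \<gamma> \<gamma> (\<lambda>_. m) (\<lambda>_. m) (\<lambda>_. lam) (\<lambda>_. lam) s1 s2 x0"

abbreviation average :: "(nat \<Rightarrow> nat \<Rightarrow> 's) \<Rightarrow> (nat \<Rightarrow> nat \<Rightarrow> 's) \<Rightarrow> 'a \<Rightarrow> 'a" where
  "average s1 s2 x0 \<equiv> seg_average G \<gamma> \<gamma> (\<lambda>_. m) (\<lambda>_. m) (\<lambda>_. lam) (\<lambda>_. lam) s1 s2 x0 K"

lemma seg_extrapolate_eq:
  "seg_extrapolate G \<gamma> (\<lambda>_. m) (\<lambda>_. lam) s1 k x = extrapolate k (case_sum (\<lambda>(k, i). s1 k i) q) x"
  by (simp add: seg_extrapolate_def extrapolate_def)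

lemma seg_iterate_Suc_eq:
  "iterate s1 s2 x0 (Suc k) = update k (case_sum (\<lambda>(k, i). s1 k i) (\<lambda>(k, i). s2 k i)) (iterate s1 s2 x0 k)"
  by (simp add: Let_def update_def extrapolate_def seg_extrapolate_def)

text \<open>Along good states freezing never acts, so the stopped process is the algorithm
  itself.\<close>

lemma iterate_eq_chain:
  fixes s1 s2 :: "nat \<Rightarrow> nat \<Rightarrow> 's"
  defines "q \<equiv> case_sum (\<lambda>(k, i). s1 k i) (\<lambda>(k, i). s2 k i)"
  assumes "\<forall>k<n. good (chain step (x0, 0, 0) (\<lambda>_. q) k)"
  shows "fst (chain step (x0, 0, 0) (\<lambda>_. q) n) = iterate s1 s2 x0 n"
  using assms(2)
proof (induction n)
  case (Suc n)
  then show ?case by (simp add: step_def q_def seg_iterate_Suc_eq del: seg_iterate.simps)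
qed simp

text \<open>\<open>F u \<bullet> (x - u)\<close> is affine in \<open>x\<close>, so the mean over the
  \<open>K + 1\<close> extrapolated points is the value at their average. The bound is uniform in
  \<open>u\<close> and passes to the supremum.\<close>

lemma gap_average_le:
  fixes s1 s2 :: "nat \<Rightarrow> nat \<Rightarrow> 's"
  defines "q \<equiv> case_sum (\<lambda>(k, i). s1 k i) (\<lambda>(k, i). s2 k i)"
  assumes x0: "norm (x0 - xstar) \<le> R"
    and V: "snd (snd (chain step (x0, 0, 0) (\<lambda>_. q) (Suc K))) \<le> 3 * R\<^sup>2"
  shows "gap F xstar R (average s1 s2 x0) \<le> 9 * R\<^sup>2 / (2 * \<gamma> * (real K + 1))"
  unfolding gap_def
proof (rule cSUP_least)
  show "cball xstar R \<noteq> {}" using R_pos by simp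
next
  fix u assume "u \<in> cball xstar R"
  then have u: "norm (u - xstar) \<le> R" by (simp add: dist_norm norm_minus_commute)
  define xt where "xt k = seg_extrapolate G \<gamma> (\<lambda>_. m) (\<lambda>_. lam) s1 k (iterate s1 s2 x0 k)" for k
  have good: "\<forall>k\<le>Suc K. good (chain step (x0, 0, 0) (\<lambda>_. q) k)"
    by (rule chain_deterministic(1)[OF x0 V])
  have "extrapolate k q (fst (chain step (x0, 0, 0) (\<lambda>_. q) k)) = xt k" if "k < Suc K" for k
    using iterate_eq_chain[of k x0 s1 s2] good that
    by (simp add: xt_def q_def seg_extrapolate_eq[of _ _ _ "\<lambda>(k, i). s2 k i"])
  then have "(\<Sum>k<Suc K. F u \<bullet> (extrapolate k q (fst (chain step (x0, 0, 0) (\<lambda>_. q) k)) - u))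
      = (\<Sum>k<Suc K. F u \<bullet> (xt k - u))"
    by (intro sum.cong) auto
  then have "2 * \<gamma> * (\<Sum>k<Suc K. F u \<bullet> (xt k - u)) \<le> 9 * R\<^sup>2"
    using chain_deterministic(2)[OF x0 V u] by (simp only:)
  moreover have "(\<Sum>k<Suc K. F u \<bullet> (xt k - u)) = (real K + 1) * (F u \<bullet> (average s1 s2 x0 - u))"
  proof -
    have "(real K + 1) *\<^sub>R average s1 s2 x0 = (\<Sum>k<Suc K. xt k)"
      unfolding seg_average_def xt_def by (simp add: atLeast0AtMost lessThan_Suc_atMost add_nonneg_eq_0_iff)
    then have "(\<Sum>k<Suc K. xt k - u) = (real K + 1) *\<^sub>R (average s1 s2 x0 - u)"
      by (simp add: sum_subtractf scaleR_diff_right sum_constant_scaleR add.commute del: sum.lessThan_Suc)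
    then show ?thesis by (simp flip: inner_sum_right del: sum.lessThan_Suc)
  qed
  ultimately have "(F u \<bullet> (average s1 s2 x0 - u)) * (2 * \<gamma> * (real K + 1)) \<le> 9 * R\<^sup>2"
    by (simp only: ac_simps)
  then show "F u \<bullet> (average s1 s2 x0 - u) \<le> 9 * R\<^sup>2 / (2 * \<gamma> * (real K + 1))"
    using \<gamma>_pos by (subst pos_le_divide_eq) auto
qed

section \<open>Measurability of the success event\<close>

lemma continuous_on_F: "continuous_on (cball xstar R) F"
proof (rule continuous_on_subset)
  show "continuous_on (cball xstar (4 * R)) F"
    using Lipschitz L_pos by (intro lipschitz_on_continuous_on[of L] lipschitz_onI) (auto simp: dist_norm)
qed (use R_pos in auto)

text \<open>As a supremum of functions affine in \<open>x\<close>, the gap has sublevel sets that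
  are intersections of closed sets; compactness of the ball and continuity of \<open>F\<close> keep
  the supremum finite.\<close>

lemma closed_gap_le: "closed {x. gap F xstar R x \<le> b}"
proof -
  have ne: "cball xstar R \<noteq> {}" using R_pos by simp
  have bdd: "bdd_above ((\<lambda>y. F y \<bullet> (x - y)) ` cball xstar R)" for x
    by (intro bounded_imp_bdd_above compact_imp_bounded compact_continuous_image
        continuous_intros continuous_on_F compact_cball)
  have "{x. gap F xstar R x \<le> b} = (\<Inter>y\<in>cball xstar R. {x. F y \<bullet> (x - y) \<le> b})"
    unfolding gap_def using cSUP_le_iff[OF ne bdd] by auto
  moreover have "closed {x. F y \<bullet> (x - y) \<le> b}" for y
    by (intro closed_Collect_le continuous_intros)
  ultimately show ?thesis by auto
qed

lemma gap_event_measurable: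
  assumes s: "\<And>k i. (\<lambda>w. s1 w k i) \<in> M \<rightarrow>\<^sub>M D" "\<And>k i. (\<lambda>w. s2 w k i) \<in> M \<rightarrow>\<^sub>M D"
  shows "{w \<in> space M. gap F xstar R (average (s1 w) (s2 w) x0) \<le> b} \<in> sets M"
proof -
  have ext: "(\<lambda>w. seg_extrapolate G \<gamma> (\<lambda>_. m) (\<lambda>_. lam) (s1 w) k (x w)) \<in> borel_measurable M"
    if [measurable]: "x \<in> borel_measurable M" for k x
  proof -
    have [measurable]: "(\<lambda>w. minibatch G m (s1 w k) (x w)) \<in> borel_measurable M"
      using s by (intro measurable_minibatch that) auto
    show ?thesis unfolding seg_extrapolate_def by measurable
  qed
  have it: "(\<lambda>w. iterate (s1 w) (s2 w) x0 k) \<in> borel_measurable M" for k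
  proof (induction k)
    case (Suc k)
    note [measurable] = Suc
    have [measurable]: "(\<lambda>w. minibatch G m (s2 w k)
        (seg_extrapolate G \<gamma> (\<lambda>_. m) (\<lambda>_. lam) (s1 w) k (iterate (s1 w) (s2 w) x0 k))) \<in> borel_measurable M"
      using s by (intro measurable_minibatch ext Suc) auto
    show ?case by (simp add: Let_def)
  qed simp
  have "(\<lambda>w. average (s1 w) (s2 w) x0) \<in> borel_measurable M"
    unfolding seg_average_def
    by (intro borel_measurable_scaleR borel_measurable_const borel_measurable_sum ext it)
  then have "(\<lambda>w. average (s1 w) (s2 w) x0) -` {x. gap F xstar R x \<le> b} \<inter> space M \<in> sets M"
    by (rule measurable_sets) (simp add: borel_closed closed_gap_le)
  moreover have "(\<lambda>w. average (s1 w) (s2 w) x0) -` {x. gap F xstar R x \<le> b} \<inter> space M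
      = {w \<in> space M. gap F xstar R (average (s1 w) (s2 w) x0) \<le> b}" by auto
  ultimately show ?thesis by simp
qed

section \<open>Tail bound by Markov's inequality\<close>

theorem gap_high_probability:
  fixes M :: "'w measure" and xi1 xi2 :: "nat \<Rightarrow> nat \<Rightarrow> 'w \<Rightarrow> 's"
  assumes M: "prob_space M"
    and indep: "prob_space.indep_vars M (\<lambda>_. D)
           (case_sum (\<lambda>(k, i). xi1 k i) (\<lambda>(k, i). xi2 k i)) (UNIV :: index set)"
    and distr: "\<And>k i. distr M D (xi1 k i) = D" "\<And>k i. distr M D (xi2 k i) = D"
    and x0: "norm (x0 - xstar) \<le> R"
  shows "measure M {w \<in> space M. gap F xstar R (average (\<lambda>k i. xi1 k i w) (\<lambda>k i. xi2 k i w) x0)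
           \<le> 9 * R\<^sup>2 / (2 * \<gamma> * (real K + 1))} \<ge> 1 - exp (- l)"
    (is "measure M ?A \<ge> _")
proof -
  interpret prob_space M by (rule M)
  define X where "X = (case_sum (\<lambda>(k, i). xi1 k i) (\<lambda>(k, i). xi2 k i) :: index \<Rightarrow> 'w \<Rightarrow> 's)"
  define Z where "Z = (\<lambda>k w. restrict (\<lambda>i. X i w) (block k))"
  define N where "N = (\<lambda>k. PiM (block k) (\<lambda>_. D))"
  define V where "V w = snd (snd (chain step (x0, 0, 0) (\<lambda>k. Z k w) (Suc K)))" for w
  have rv: "X i \<in> M \<rightarrow>\<^sub>M D" for i using indep unfolding X_def[symmetric] indep_vars_def by simp
  have rv1: "xi1 k i \<in> M \<rightarrow>\<^sub>M D" and rv2: "xi2 k i \<in> M \<rightarrow>\<^sub>M D" for k i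
    using rv[of "Inl (k, i)"] rv[of "Inr (k, i)"] by (simp_all add: X_def)
  have Z: "indep_vars N Z UNIV"
    unfolding N_def Z_def
    by (rule indep_vars_restrict[OF indep[folded X_def]]) (auto simp: disjoint_family_on_def)
  have dX: "distr M D (X i) = D" for i
    using distr by (auto simp: X_def split: sum.split prod.split)
  have dZ: "distr M (N k) (Z k) = N k" for k
  proof -
    \<comment> \<open>The characterisation of independence by product laws is for nonempty index
      sets.\<close>
    have "block k \<noteq> {}" using m_ge by auto
    moreover have "indep_vars (\<lambda>_. D) X (block k)"
      by (rule indep_vars_subset[OF indep[folded X_def]]) simp
    ultimately have "distr M (PiM (block k) (\<lambda>_. D)) (\<lambda>w. \<lambda>i\<in>block k. X i w)
        = PiM (block k) (\<lambda>i. distr M D (X i))"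
      using indep_vars_iff_distr_eq_PiM[of "block k" X "\<lambda>_. D"] rv by simp
    then show ?thesis by (simp add: N_def Z_def dX)
  qed
  have T: "(\<lambda>(st, p). step k p st) \<in> borel \<Otimes>\<^sub>M N k \<rightarrow>\<^sub>M borel" for k
    unfolding N_def by (rule measurable_step)
  have snd_meas: "(\<lambda>st :: 'a \<times> 'a \<times> real. snd (snd st)) \<in> borel_measurable borel"
    unfolding borel_prod[symmetric] by measurable
  have f: "(\<lambda>st :: 'a \<times> 'a \<times> real. ennreal (exp (l / R\<^sup>2 * snd (snd st)))) \<in> borel_measurable borel"
    using snd_meas by measurable
  have "(\<integral>\<^sup>+ w. ennreal (exp (l / R\<^sup>2 * V w)) \<partial>M)
      \<le> ennreal (exp (l / (real K + 1))) ^ Suc K * ennreal (exp (l / R\<^sup>2 * snd (snd (x0, 0 :: 'a, 0 :: real))))"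
    unfolding V_def
  proof (rule nn_integral_chain_le[OF T _ Z f])
    show "(\<integral>\<^sup>+ p. ennreal (exp (l / R\<^sup>2 * snd (snd (step k p st)))) \<partial>distr M (N k) (Z k))
        \<le> ennreal (exp (l / (real K + 1))) * ennreal (exp (l / R\<^sup>2 * snd (snd st)))" for k st
      unfolding dZ by (unfold N_def) (rule step_exp_moment)
  qed simp
  also have "\<dots> = ennreal (exp l)"
    by (simp add: ennreal_power add.commute flip: exp_of_nat_mult del: power_Suc)
  finally have mom: "(\<integral>\<^sup>+ w. ennreal (exp (l / R\<^sup>2 * V w)) \<partial>M) \<le> ennreal (exp l)" .
  have Vm[measurable]: "V \<in> borel_measurable M"
  proof -
    have "Z k \<in> M \<rightarrow>\<^sub>M N k" for k using Z by (simp add: indep_vars_def)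
    then have "(\<lambda>w. chain step (x0, 0, 0) (\<lambda>k. Z k w) (Suc K)) \<in> M \<rightarrow>\<^sub>M borel"
      by (intro measurable_chain[OF T]) auto
    from measurable_compose[OF this snd_meas] show ?thesis by (simp add: V_def[abs_def])
  qed
  \<comment> \<open>The event \<open>V w \<ge> 3 * R\<^sup>2\<close> in exponential form. Its level
    \<open>exp (3 * l)\<close> against the moment bound \<open>exp l\<close> leaves probability at
    most \<open>exp (- (2 * l))\<close>.\<close>
  let ?B = "{w \<in> space M. ennreal (exp (3 * l)) \<le> ennreal (exp (l / R\<^sup>2 * V w))}"
  have B: "?B \<in> sets M" by measurable
  have "ennreal (exp (3 * l)) * emeasure M ?B \<le> (\<integral>\<^sup>+ w. ennreal (exp (l / R\<^sup>2 * V w)) \<partial>M)"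
  proof -
    have "ennreal (exp (3 * l)) * emeasure M ?B = (\<integral>\<^sup>+ w. ennreal (exp (3 * l)) * indicator ?B w \<partial>M)"
      using B by (simp add: nn_integral_cmult_indicator)
    also have "\<dots> \<le> (\<integral>\<^sup>+ w. ennreal (exp (l / R\<^sup>2 * V w)) \<partial>M)"
      by (intro nn_integral_mono) (auto split: split_indicator)
    finally show ?thesis .
  qed
  with mom have "ennreal (exp (3 * l)) * ennreal (measure M ?B) \<le> ennreal (exp l)"
    by (simp add: emeasure_eq_measure)
  then have "exp (3 * l) * measure M ?B \<le> exp l" by (simp flip: ennreal_mult)
  then have "exp l * (exp (2 * l) * measure M ?B) \<le> exp l * 1"
    by (simp only: mult.assoc[symmetric] flip: exp_add) (simp add: mult.commute)
  then have "exp (2 * l) * measure M ?B \<le> 1" by (simp only: mult_le_cancel_left_pos exp_gt_zero)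
  then have "measure M ?B \<le> exp (- (2 * l))"
    by (simp add: exp_minus field_simps)
  also have "\<dots> \<le> exp (- l)" using l_ge by simp
  finally have PB: "measure M ?B \<le> exp (- l)" .
  have "space M - ?B \<subseteq> ?A"
  proof safe
    fix w assume w: "w \<in> space M" "\<not> ennreal (exp (3 * l)) \<le> ennreal (exp (l / R\<^sup>2 * V w))"
    then have "l * V w < l * (3 * R\<^sup>2)" using R_pos by (simp add: field_simps)
    then have "V w \<le> 3 * R\<^sup>2" using l_ge by simp
    \<comment> \<open>The moment bound used independent blocks, the path lemmas one full sample
      table; \<open>step_cong\<close> identifies the two.\<close>
    moreover have "chain step (x0, 0, 0) (\<lambda>k. Z k w) n = chain step (x0, 0, 0) (\<lambda>_ i. X i w) n" for n
    proof (induction n)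
      case (Suc n)
      have "step n (Z n w) st = step n (\<lambda>i. X i w) st" for st
        by (rule step_cong) (simp add: Z_def)
      with Suc show ?case by simp
    qed simp
    moreover have "(\<lambda>i. X i w) = case_sum (\<lambda>(k, i). xi1 k i w) (\<lambda>(k, i). xi2 k i w)"
      by (auto simp: X_def fun_eq_iff split: sum.split)
    ultimately have "snd (snd (chain step (x0, 0, 0)
        (\<lambda>_. case_sum (\<lambda>(k, i). xi1 k i w) (\<lambda>(k, i). xi2 k i w)) (Suc K))) \<le> 3 * R\<^sup>2"
      unfolding V_def by (simp del: chain.simps)
    then show "gap F xstar R (average (\<lambda>k i. xi1 k i w) (\<lambda>k i. xi2 k i w) x0)
        \<le> 9 * R\<^sup>2 / (2 * \<gamma> * (real K + 1))"
      by (rule gap_average_le[OF x0])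
  qed
  then have "measure M (space M - ?B) \<le> measure M ?A"
    using rv1 rv2 by (intro finite_measure_mono gap_event_measurable) auto
  then show ?thesis using PB prob_compl[OF B] by linarith
qed

end

section \<open>Stepsizes, batchsizes and complexity\<close>

lemma log_factor_ge_1: "0 < \<beta> \<Longrightarrow> \<beta> \<le> 1 \<Longrightarrow> 1 \<le> log_factor K \<beta>"
proof -
  assume b: "0 < \<beta>" "\<beta> \<le> 1"
  have "exp 1 \<le> (3 :: real)" by (rule exp_le)
  also have "3 \<le> 6 * (real K + 1) / \<beta>"
    using b mult_mono[of 1 "real K + 1" \<beta> 1] by (simp add: pos_le_divide_eq)
  finally show ?thesis
    using b unfolding log_factor_def by (subst ln_ge_iff) (auto intro!: divide_pos_pos mult_pos_pos)
qed

lemma exp_uminus_log_factor_le: "0 < \<beta> \<Longrightarrow> exp (- log_factor K \<beta>) \<le> \<beta>"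
proof -
  assume b: "0 < \<beta>"
  have "exp (- log_factor K \<beta>) = \<beta> / (6 * (real K + 1))"
    using b unfolding log_factor_def by (subst exp_minus, subst exp_ln) (auto intro!: divide_pos_pos mult_pos_pos)
  also have "\<dots> \<le> \<beta> / 1" using b by (intro divide_left_mono) auto
  finally show ?thesis by simp
qed

lemma ln2_ge_half: "1 / 2 \<le> ln (2 :: real)"
  using ln_le_minus_one[of "1 / 2 :: real"] by (simp add: ln_div)

text \<open>
  With \<open>u = n / a\<close>, the logarithm splits as \<open>ln (a / \<beta>) + ln (6 u)\<close>; the hypothesis on \<open>n\<close> pays for the
  first summand, and \<open>u \<ge> C ln 2\<close> together with the tangent of \<open>ln\<close> at \<open>2 ^ p\<close> for the second.
\<close>

lemma sufficient_iterations:
  fixes a \<beta> c C n :: real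
  assumes a: "0 < a" and \<beta>: "0 < \<beta>" and ab: "2 \<le> a / \<beta>" and C: "0 < C"
    and c: "0 \<le> c" "2 * c \<le> C" "24 * c \<le> 2 ^ p" "8 * c * real p \<le> C"
    and n: "C * (a * ln (a / \<beta>)) \<le> n"
  shows "c * a * ln (6 * n / \<beta>) \<le> n"
proof -
  define u where "u = n / a"
  have ln2: "1 / 2 \<le> ln (a / \<beta>)"
    using ln2_ge_half ab ln_le_cancel_iff[of 2 "a / \<beta>"] by linarith
  have "C * (1 / 2) * a \<le> C * ln (a / \<beta>) * a"
    using ln2 a C by (intro mult_right_mono mult_left_mono) auto
  also have "\<dots> \<le> n" using n by (simp add: ac_simps)
  finally have u: "C / 2 \<le> u" unfolding u_def using a by (simp add: field_simps)
  have u0: "0 < u" using u C by linarith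
  have nu: "n = u * a" unfolding u_def using a by simp
  have "6 * n / \<beta> = (a / \<beta>) * (6 * u)" by (simp add: nu)
  then have split: "ln (6 * n / \<beta>) = ln (a / \<beta>) + ln (6 * u)"
    using a \<beta> u0 by (subst \<open>_ = (a / \<beta>) * (6 * u)\<close>, intro ln_mult_pos) auto
  have "ln (6 * u) = ln (6 * u / 2 ^ p) + real p * ln 2"
    using u0 by (simp add: ln_div ln_realpow)
  also have "\<dots> \<le> 6 * u / 2 ^ p + real p * 1"
    using u0 ln_le_minus_one[of "6 * u / 2 ^ p"] ln_le_minus_one[of "2 :: real"]
    by (intro add_mono mult_left_mono) auto
  finally have "c * ln (6 * u) \<le> c * (6 * u / 2 ^ p + real p)" using c(1) by (simp add: mult_left_mono)
  also have "\<dots> = (24 * c) * (u / 4) / 2 ^ p + 8 * c * real p / 8" by (simp add: field_simps)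
  \<comment> \<open>Each summand is at most \<open>u / 4\<close>: the first by
    \<open>24 * c \<le> 2 ^ p\<close>, the second by \<open>8 * c * real p \<le> C\<close> and
    \<open>C / 2 \<le> u\<close>.\<close>
  also have "\<dots> \<le> 2 ^ p * (u / 4) / 2 ^ p + C / 8"
    using c u0 by (intro add_mono divide_right_mono mult_right_mono) auto
  also have "\<dots> \<le> u / 2" using u by simp
  finally have "c * ln (6 * u) \<le> u / 2" .
  then have 1: "a * (c * ln (6 * u)) \<le> a * (u / 2)" using a by (intro mult_left_mono) auto
  have "2 * c * (a * ln (a / \<beta>)) \<le> C * (a * ln (a / \<beta>))"
    using c(2) a ln2 by (intro mult_right_mono) auto
  then have 2: "c * (a * ln (a / \<beta>)) \<le> n / 2" using n by linarith
  have "c * a * ln (6 * n / \<beta>) = c * (a * ln (a / \<beta>)) + a * (c * ln (6 * u))"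
    unfolding split by (simp add: algebra_simps)
  also have "\<dots> \<le> n / 2 + a * (u / 2)" using 1 2 by (rule add_mono[rotated])
  finally show ?thesis unfolding nu by (simp add: field_simps)
qed

lemma floor_iterations:
  assumes "0 \<le> (x :: real)"
  shows "real (nat \<lfloor>x\<rfloor>) \<le> x" and "x \<le> real (nat \<lfloor>x\<rfloor>) + 1"
proof -
  show "real (nat \<lfloor>x\<rfloor>) \<le> x" using assms by (rule of_nat_floor)
  show "x \<le> real (nat \<lfloor>x\<rfloor>) + 1" using assms by linarith
qed

section \<open>Admissible parameters and gap bounds\<close>

text \<open>\<open>K\<close>, stepsize and batchsize are left open, since the complexity bounds
  choose \<open>K\<close> from the target accuracy.\<close>

locale seg_problem =
  fixes M :: "'w measure" and D :: "'s measure"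
    and G :: "'s \<Rightarrow> 'a::euclidean_space \<Rightarrow> 'a" and F :: "'a \<Rightarrow> 'a"
    and xi1 xi2 :: "nat \<Rightarrow> nat \<Rightarrow> 'w \<Rightarrow> 's" and x0 xstar :: 'a and R L \<sigma> \<beta> :: real
  assumes D: "prob_space D" and M: "prob_space M"
    and G_meas: "(\<lambda>(s, x). G s x) \<in> borel_measurable (D \<Otimes>\<^sub>M borel)"
    and G_int: "\<And>x. integrable D (\<lambda>s. G s x)"
    and F_eq: "\<And>x. F x = (LINT s|D. G s x)"
    and indep: "prob_space.indep_vars M (\<lambda>_. D)
           (case_sum (\<lambda>(k, i). xi1 k i) (\<lambda>(k, i). xi2 k i)) (UNIV :: index set)"
    and distr1: "\<And>k i. distr M D (xi1 k i) = D" and distr2: "\<And>k i. distr M D (xi2 k i) = D"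
    and F_xstar: "F xstar = 0"
    and R_pos: "0 < R" and x0: "norm (x0 - xstar) \<le> R"
    and \<sigma>_nonneg: "0 \<le> \<sigma>" and L_pos: "0 < L"
    and var_int: "\<And>x. x \<in> cball xstar (4 * R) \<Longrightarrow> integrable D (\<lambda>s. (norm (G s x - F x))\<^sup>2)"
    and var_le: "\<And>x. x \<in> cball xstar (4 * R) \<Longrightarrow> (LINT s|D. (norm (G s x - F x))\<^sup>2) \<le> \<sigma>\<^sup>2"
    and Lipschitz: "\<And>x y. x \<in> cball xstar (4 * R) \<Longrightarrow> y \<in> cball xstar (4 * R) \<Longrightarrow>
           norm (F x - F y) \<le> L * norm (x - y)"
    and monotone: "\<And>x y. x \<in> cball xstar (4 * R) \<Longrightarrow> y \<in> cball xstar (4 * R) \<Longrightarrow>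
           (F x - F y) \<bullet> (x - y) \<ge> 0"
    and \<beta>_pos: "0 < \<beta>" and \<beta>_le: "\<beta> \<le> 1"
begin

lemma l_ge: "1 \<le> log_factor K \<beta>"
  using \<beta>_pos \<beta>_le by (rule log_factor_ge_1)

text \<open>The free bound \<open>b\<close> lets one lemma serve both the closed-form gap bounds and
  the target accuracy.\<close>

lemma success_prob:
  assumes \<gamma>: "stepsize_cond L K \<beta> \<gamma>" and m: "batch_cond R \<sigma> K \<beta> \<gamma> m"
    and b: "9 * R\<^sup>2 / (2 * \<gamma> * (real K + 1)) \<le> b"
  shows "seg_success_prob M G F xi1 xi2 x0 xstar R \<beta> K \<gamma> m b \<ge> 1 - \<beta>"
proof -
  interpret P: prob_space M by (rule M)
  interpret clipped_seg D G F xstar R L \<sigma> "log_factor K \<beta>" \<gamma> m K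
  proof (rule clipped_seg.intro)
    show "1 \<le> m" "10800 * (real K + 1) * \<gamma>\<^sup>2 * \<sigma>\<^sup>2 * log_factor K \<beta> / R\<^sup>2 \<le> real m"
      using m by (auto simp: batch_cond_def)
    show "0 < \<gamma>" "\<gamma> \<le> 1 / (160 * L * log_factor K \<beta>)" using \<gamma> by (auto simp: stepsize_cond_def)
  qed (fact D G_meas G_int F_eq F_xstar R_pos L_pos var_int var_le Lipschitz monotone l_ge)+
  have rv: "case_sum (\<lambda>(k, i). xi1 k i) (\<lambda>(k, i). xi2 k i) j \<in> M \<rightarrow>\<^sub>M D" for j :: index
    using indep by (simp add: P.indep_vars_def)
  have "{w \<in> space M. gap F xstar R (average (\<lambda>k i. xi1 k i w) (\<lambda>k i. xi2 k i w) x0)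
      \<le> 9 * R\<^sup>2 / (2 * \<gamma> * (real K + 1))}
    \<subseteq> {w \<in> space M. gap F xstar R (average (\<lambda>k i. xi1 k i w) (\<lambda>k i. xi2 k i w) x0) \<le> b}"
    using b by auto
  moreover have "{w \<in> space M. gap F xstar R (average (\<lambda>k i. xi1 k i w) (\<lambda>k i. xi2 k i w) x0) \<le> b} \<in> sets M"
    using rv[of "Inl (_, _)"] rv[of "Inr (_, _)"] by (intro gap_event_measurable) auto
  ultimately have "measure M {w \<in> space M. gap F xstar R (average (\<lambda>k i. xi1 k i w) (\<lambda>k i. xi2 k i w) x0)
      \<le> 9 * R\<^sup>2 / (2 * \<gamma> * (real K + 1))}
    \<le> measure M {w \<in> space M. gap F xstar R (average (\<lambda>k i. xi1 k i w) (\<lambda>k i. xi2 k i w) x0) \<le> b}"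
    by (rule P.finite_measure_mono)
  then have "1 - exp (- log_factor K \<beta>)
      \<le> measure M {w \<in> space M. gap F xstar R (average (\<lambda>k i. xi1 k i w) (\<lambda>k i. xi2 k i w) x0) \<le> b}"
    using gap_high_probability[OF M indep distr1 distr2 x0] by linarith
  then show ?thesis
    using exp_uminus_log_factor_le[OF \<beta>_pos, of K] unfolding seg_success_prob_def clip_level_def lam_def
    by linarith
qed

lemma large_stepsize_cond: "stepsize_cond L K \<beta> (large_stepsize L K \<beta>)"
  using L_pos l_ge[of K] by (simp add: stepsize_cond_def large_stepsize_def)

lemma large_batch_cond: "batch_cond R \<sigma> K \<beta> (large_stepsize L K \<beta>) (large_batch L R \<sigma> K \<beta>)"
proof -
  define l where "l = log_factor K \<beta>"
  have l: "0 < l" using l_ge[of K] by (simp add: l_def)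
  \<comment> \<open>The constants match because
    \<open>10800 / 160\<^sup>2 = 27 / 64\<close>.\<close>
  have "10800 * (real K + 1) * (large_stepsize L K \<beta>)\<^sup>2 * \<sigma>\<^sup>2 * l / R\<^sup>2
      = 27 * (real K + 1) * \<sigma>\<^sup>2 / (64 * L\<^sup>2 * R\<^sup>2 * l)"
    unfolding large_stepsize_def l_def[symmetric] using l L_pos R_pos
    by (simp add: field_simps power2_eq_square)
  then show ?thesis
    unfolding batch_cond_def large_batch_def l_def by simp
qed

lemma large_gap_bound:
  "9 * R\<^sup>2 / (2 * large_stepsize L K \<beta> * (real K + 1)) = 720 * L * R\<^sup>2 * log_factor K \<beta> / (real K + 1)"
  unfolding large_stepsize_def by simp

lemma small_stepsize_cond: "stepsize_cond L K \<beta> (small_stepsize L R \<sigma> K \<beta>)"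
  using L_pos R_pos \<sigma>_nonneg l_ge[of K] by (simp add: stepsize_cond_def small_stepsize_def)

text \<open>For positive \<open>\<sigma>\<close> the second entry of the minimum is made for this:
  its square has \<open>60\<^sup>2 * 3 = 10800\<close> in the denominator.\<close>

lemma small_batch_cond: "batch_cond R \<sigma> K \<beta> (small_stepsize L R \<sigma> K \<beta>) 1"
proof (cases "\<sigma> = 0")
  case False
  define l where "l = log_factor K \<beta>"
  define h where "h = 3 * (real K + 1) * l"
  have l: "0 < l" and h: "0 < h" using l_ge[of K] by (simp_all add: l_def h_def)
  have \<sigma>: "0 < \<sigma>" using False \<sigma>_nonneg by simp
  have "small_stepsize L R \<sigma> K \<beta> \<le> R / (60 * \<sigma> * sqrt h)"
    using False by (simp add: small_stepsize_def h_def l_def)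
  then have "(small_stepsize L R \<sigma> K \<beta>)\<^sup>2 \<le> (R / (60 * \<sigma> * sqrt h))\<^sup>2"
    using small_stepsize_cond by (intro power_mono) (auto simp: stepsize_cond_def less_imp_le)
  also have "\<dots> = R\<^sup>2 / (3600 * \<sigma>\<^sup>2 * h)" using h by (simp add: power_divide power_mult_distrib)
  finally have "(small_stepsize L R \<sigma> K \<beta>)\<^sup>2 * (3600 * \<sigma>\<^sup>2 * h) \<le> R\<^sup>2"
    using \<sigma> h by (simp add: pos_le_divide_eq)
  then show ?thesis
    using R_pos unfolding batch_cond_def l_def[symmetric]
    by (simp add: h_def pos_divide_le_eq ac_simps)
qed (simp add: batch_cond_def)

text \<open>Whichever entry attains the minimum defining the stepsize yields the corresponding entry
  of the maximum.\<close>

lemma small_gap_bound: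
  "9 * R\<^sup>2 / (2 * small_stepsize L R \<sigma> K \<beta> * (real K + 1))
     \<le> max (720 * L * R\<^sup>2 * log_factor K \<beta> / (real K + 1))
           (270 * \<sigma> * R * sqrt (3 * log_factor K \<beta>) / sqrt (real K + 1))"
proof (cases "small_stepsize L R \<sigma> K \<beta> = large_stepsize L K \<beta>")
  case True
  then show ?thesis unfolding True large_gap_bound by simp
next
  case False
  define l where "l = log_factor K \<beta>"
  define n where "n = real K + 1"
  have n: "0 < n" and l: "0 < l" using l_ge[of K] by (simp_all add: n_def l_def)
  have \<sigma>: "0 < \<sigma>"
    using False \<sigma>_nonneg by (cases "\<sigma> = 0") (auto simp: small_stepsize_def large_stepsize_def)
  have s: "small_stepsize L R \<sigma> K \<beta> = R / (60 * \<sigma> * sqrt (3 * n * l))"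
    using False by (auto simp: small_stepsize_def large_stepsize_def n_def l_def min_def split: if_splits)
  have "9 * R\<^sup>2 / (2 * small_stepsize L R \<sigma> K \<beta> * n) = 270 * \<sigma> * R * (sqrt (3 * l) * (sqrt n / n))"
    unfolding s using R_pos \<sigma> n l
    by (simp add: real_sqrt_mult power2_eq_square field_simps)
  also have "sqrt n / n = 1 / sqrt n" using n by (simp add: field_simps)
  finally show ?thesis unfolding n_def l_def by simp
qed

section \<open>Complexity bounds\<close>

lemma complexity_large:
  assumes \<epsilon>: "0 < \<epsilon>" and large: "2 \<le> L * R\<^sup>2 / (\<epsilon> * \<beta>)"
  shows "\<exists>K. log_factor K \<beta> \<ge> 1 \<and>
    seg_success_prob M G F xi1 xi2 x0 xstar R \<beta> K
      (large_stepsize L K \<beta>) (large_batch L R \<sigma> K \<beta>) \<epsilon> \<ge> 1 - \<beta> \<and>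
    real K \<le> O_const * (L * R\<^sup>2 / \<epsilon> * ln (L * R\<^sup>2 / (\<epsilon> * \<beta>))) \<and>
    (\<epsilon> \<le> L * R\<^sup>2 \<longrightarrow>
       real (oracle_calls (large_batch L R \<sigma> K \<beta>) K)
         \<le> O_const * (max (L * R\<^sup>2 / \<epsilon>) (\<sigma>\<^sup>2 * R\<^sup>2 / \<epsilon>\<^sup>2) * ln (L * R\<^sup>2 / (\<epsilon> * \<beta>))))"
proof -
  define a where "a = L * R\<^sup>2 / \<epsilon>"
  define b where "b = \<sigma>\<^sup>2 * R\<^sup>2 / \<epsilon>\<^sup>2"
  define t where "t = ln (a / \<beta>)"
  define C :: real where "C = 10 ^ 5"
  \<comment> \<open>Rounding down keeps \<open>K\<close> below the claimed bound, while
    \<open>K + 1\<close>, which enters the gap bound, is still at least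
    \<open>C * (a * t)\<close>.\<close>
  define K where "K = nat \<lfloor>C * (a * t)\<rfloor>"
  define n where "n = real K + 1"
  define l where "l = log_factor K \<beta>"
  have a: "0 < a" unfolding a_def using L_pos R_pos \<epsilon> by simp
  have ab: "2 \<le> a / \<beta>" and arg: "L * R\<^sup>2 / (\<epsilon> * \<beta>) = a / \<beta>" using large by (simp_all add: a_def)
  have t: "1 / 2 \<le> t"
    unfolding t_def using ln2_ge_half ab ln_le_cancel_iff[of 2 "a / \<beta>"] by linarith
  have at: "0 \<le> C * (a * t)" using a t by (simp add: C_def)
  note K = floor_iterations[OF at, folded K_def]
  have n0: "0 < n" and nC: "C * (a * t) \<le> n" using K by (simp_all add: n_def)
  have l: "l = ln (6 * n / \<beta>)" and l1: "1 \<le> l" using l_ge[of K] by (simp_all add: l_def n_def log_factor_def)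
  \<comment> \<open>\<open>24 * 720 \<le> 2 ^ 15\<close> and
    \<open>8 * 720 * 15 = 86400 \<le> C\<close>.\<close>
  have suff: "720 * a * l \<le> n"
    unfolding l by (rule sufficient_iterations[where C = C and p = 15])
      (use a \<beta>_pos ab nC in \<open>auto simp: C_def t_def\<close>)
  have "9 * R\<^sup>2 / (2 * large_stepsize L K \<beta> * (real K + 1)) \<le> \<epsilon>"
    unfolding large_gap_bound unfolding n_def[symmetric] l_def[symmetric]
    using suff n0 \<epsilon> by (simp add: a_def field_simps)
  then have succ: "seg_success_prob M G F xi1 xi2 x0 xstar R \<beta> K
      (large_stepsize L K \<beta>) (large_batch L R \<sigma> K \<beta>) \<epsilon> \<ge> 1 - \<beta>"
    by (rule success_prob[OF large_stepsize_cond large_batch_cond])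
  have iter: "real K \<le> O_const * (a * t)"
    using K(1) mult_right_mono[of C O_const "a * t"] a t by (simp add: C_def O_const_def)
  have calls: "real (oracle_calls (large_batch L R \<sigma> K \<beta>) K) \<le> O_const * (max a b * t)"
    if le: "\<epsilon> \<le> L * R\<^sup>2"
  proof -
    define X where "X = 27 * n * \<sigma>\<^sup>2 / (64 * L\<^sup>2 * R\<^sup>2 * l)"
    have a1: "1 \<le> a" unfolding a_def using le \<epsilon> by simp
    \<comment> \<open>This lower bound absorbs the \<open>+ 1\<close> in \<open>n\<close>; it rests
      on \<open>\<epsilon> \<le> L * R\<^sup>2\<close>.\<close>
    have at2: "1 / 2 \<le> a * t" using mult_mono[OF a1 t] a1 by simp
    have nle: "n \<le> (C + 2) * (a * t)" using K(1) at2 by (simp add: n_def algebra_simps)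
    have X0: "0 \<le> X" unfolding X_def using n0 l1 by simp
    have "real (large_batch L R \<sigma> K \<beta>) = of_int \<lceil>max 1 X\<rceil>"
      unfolding large_batch_def X_def n_def l_def by (subst of_nat_nat) (auto simp: le_ceiling_iff)
    also have "\<dots> \<le> max 1 X + 1" by (rule of_int_ceiling_le_add_one)
    also have "\<dots> \<le> 2 * max 1 X" by simp
    finally have "real (large_batch L R \<sigma> K \<beta>) * (2 * n) \<le> 2 * max 1 X * (2 * n)"
      using n0 by (intro mult_right_mono) auto
    moreover have "real (oracle_calls (large_batch L R \<sigma> K \<beta>) K) = real (large_batch L R \<sigma> K \<beta>) * (2 * n)"
      by (simp add: oracle_calls_def n_def algebra_simps)
    ultimately have m: "real (oracle_calls (large_batch L R \<sigma> K \<beta>) K) \<le> 4 * (n * max 1 X)"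
      by (simp add: ac_simps)
    have "4 * n \<le> 4 * (C + 2) * (a * t)"
      unfolding mult.assoc[of 4] using nle by (rule mult_left_mono) simp
    also have "\<dots> \<le> O_const * (a * t)"
      using at2 by (intro mult_right_mono) (auto simp: C_def O_const_def)
    also have "\<dots> \<le> O_const * (max a b * t)"
      using t by (intro mult_left_mono mult_right_mono) (auto simp: O_const_def)
    finally have m1: "4 * n \<le> O_const * (max a b * t)" .
    \<comment> \<open>The noise part of the calls is of order \<open>b * t\<^sup>2 / l\<close>; this
      inequality cancels one of the two logarithms.\<close>
    have tl: "t \<le> l"
    proof -
      have "a \<le> C * (1 / 2) * a" using a by (simp add: C_def)
      also have "\<dots> \<le> C * t * a" using t a by (intro mult_right_mono mult_left_mono) (auto simp: C_def)
      also have "\<dots> \<le> 6 * n" using nC n0 by (simp add: ac_simps)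
      finally show ?thesis unfolding t_def l
        using a n0 \<beta>_pos by (subst ln_le_cancel_iff) (auto intro!: divide_right_mono)
    qed
    have "4 * (n * X) = 27 / 16 * n\<^sup>2 * (\<sigma>\<^sup>2 / (L\<^sup>2 * R\<^sup>2 * l))"
      unfolding X_def by (simp add: power2_eq_square ac_simps)
    also have "\<dots> \<le> 27 / 16 * ((C + 2) * (a * t))\<^sup>2 * (\<sigma>\<^sup>2 / (L\<^sup>2 * R\<^sup>2 * l))"
      using nle n0 l1 by (intro mult_right_mono mult_left_mono power_mono) auto
    also have "\<dots> = 27 / 16 * (C + 2)\<^sup>2 * (b * t * (t / l))"
      unfolding a_def b_def using L_pos R_pos l1 \<epsilon> by (simp add: power2_eq_square field_simps)
    also have "\<dots> \<le> 27 / 16 * (C + 2)\<^sup>2 * (b * t * 1)"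
      using tl t l1 by (intro mult_left_mono) (auto simp: b_def C_def)
    also have "\<dots> \<le> O_const * (b * t)"
      using t unfolding mult_1_right by (intro mult_right_mono) (auto simp: C_def O_const_def b_def)
    also have "\<dots> \<le> O_const * (max a b * t)"
      using t by (intro mult_left_mono mult_right_mono) (auto simp: O_const_def)
    finally have m2: "4 * (n * X) \<le> O_const * (max a b * t)" .
    have "4 * (n * max 1 X) \<le> O_const * (max a b * t)"
      using linear[of 1 X] m1 m2 by (auto simp: max.absorb1 max.absorb2)
    then show ?thesis using m by (rule order_trans[rotated])
  qed
  show ?thesis
    unfolding arg unfolding a_def[symmetric] b_def[symmetric] t_def[symmetric]
    using l1[unfolded l_def] succ iter calls by blast
qed

lemma complexity_small:
  assumes \<epsilon>: "0 < \<epsilon>" and large1: "2 \<le> L * R\<^sup>2 / (\<epsilon> * \<beta>)"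
    and large2: "0 < \<sigma> \<Longrightarrow> 2 \<le> \<sigma>\<^sup>2 * R\<^sup>2 / (\<epsilon>\<^sup>2 * \<beta>)"
  defines "B \<equiv> max (L * R\<^sup>2 / \<epsilon> * ln (L * R\<^sup>2 / (\<epsilon> * \<beta>)))
                   (\<sigma>\<^sup>2 * R\<^sup>2 / \<epsilon>\<^sup>2 * ln (\<sigma>\<^sup>2 * R\<^sup>2 / (\<epsilon>\<^sup>2 * \<beta>)))"
  shows "\<exists>K. log_factor K \<beta> \<ge> 1 \<and>
    seg_success_prob M G F xi1 xi2 x0 xstar R \<beta> K (small_stepsize L R \<sigma> K \<beta>) 1 \<epsilon> \<ge> 1 - \<beta> \<and>
    real K \<le> O_const * B \<and>
    (\<epsilon> \<le> max (L * R\<^sup>2) (\<sigma> * R) \<longrightarrow> real (oracle_calls 1 K) \<le> O_const * B)"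
proof -
  define a where "a = L * R\<^sup>2 / \<epsilon>"
  define b where "b = \<sigma>\<^sup>2 * R\<^sup>2 / \<epsilon>\<^sup>2"
  define C :: real where "C = 10 ^ 9"
  define K where "K = nat \<lfloor>C * B\<rfloor>"
  define n where "n = real K + 1"
  define l where "l = log_factor K \<beta>"
  have a: "0 < a" unfolding a_def using L_pos R_pos \<epsilon> by simp
  have ab: "2 \<le> a / \<beta>" using large1 by (simp add: a_def)
  have B: "B = max (a * ln (a / \<beta>)) (b * ln (b / \<beta>))" by (simp add: B_def a_def b_def)
  have ta: "1 / 2 \<le> ln (a / \<beta>)"
    using ln2_ge_half ab ln_le_cancel_iff[of 2 "a / \<beta>"] by linarith
  have B0: "0 \<le> C * B" unfolding B using a ta by (simp add: C_def le_max_iff_disj)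
  note K = floor_iterations[OF B0, folded K_def]
  have n0: "0 < n" and nC: "C * B \<le> n" using K by (simp_all add: n_def)
  have nC1: "C * (a * ln (a / \<beta>)) \<le> n" and nC2: "C * (b * ln (b / \<beta>)) \<le> n"
    using nC by (auto simp: B C_def)
  have l: "l = ln (6 * n / \<beta>)" and l1: "1 \<le> l" using l_ge[of K] by (simp_all add: l_def n_def log_factor_def)
  have "720 * a * l \<le> n"
    unfolding l by (rule sufficient_iterations[where C = C and p = 15])
      (use a \<beta>_pos ab nC1 in \<open>auto simp: C_def\<close>)
  then have e1: "720 * L * R\<^sup>2 * l / n \<le> \<epsilon>"
    using n0 \<epsilon> by (simp add: a_def field_simps)
  \<comment> \<open>Squared, this is \<open>sufficient_iterations\<close> for
    \<open>c = 3 * 270\<^sup>2 = 218700\<close>, and \<open>24 * c \<le> 2 ^ 23\<close>. For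
    \<open>\<sigma> = 0\<close> the left side is 0, as is the second entry of
    \<open>B\<close>.\<close>
  have e2: "270 * \<sigma> * R * sqrt (3 * l) / sqrt n \<le> \<epsilon>"
  proof (cases "\<sigma> = 0")
    case False
    then have \<sigma>: "0 < \<sigma>" using \<sigma>_nonneg by simp
    have b: "0 < b" unfolding b_def using \<sigma> R_pos \<epsilon> by simp
    have bb: "2 \<le> b / \<beta>" using large2[OF \<sigma>] by (simp add: b_def)
    have "218700 * b * l \<le> n"
      unfolding l by (rule sufficient_iterations[where C = C and p = 23])
        (use b \<beta>_pos bb nC2 in \<open>auto simp: C_def\<close>)
    then have "218700 * (\<sigma>\<^sup>2 * R\<^sup>2) * l / n \<le> \<epsilon>\<^sup>2"
      using n0 \<epsilon> by (simp add: b_def field_simps)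
    also have "218700 * (\<sigma>\<^sup>2 * R\<^sup>2) * l / n = (270 * \<sigma> * R * sqrt (3 * l) / sqrt n)\<^sup>2"
      using l1 n0 by (simp add: power_mult_distrib power_divide)
    finally show ?thesis by (rule power2_le_imp_le) (use \<epsilon> in simp)
  qed (use \<epsilon> in simp)
  have "9 * R\<^sup>2 / (2 * small_stepsize L R \<sigma> K \<beta> * (real K + 1)) \<le> \<epsilon>"
    using small_gap_bound[of K] e1 e2 unfolding n_def[symmetric] l_def[symmetric] by linarith
  then have succ: "seg_success_prob M G F xi1 xi2 x0 xstar R \<beta> K (small_stepsize L R \<sigma> K \<beta>) 1 \<epsilon> \<ge> 1 - \<beta>"
    by (rule success_prob[OF small_stepsize_cond small_batch_cond])
  have iter: "real K \<le> O_const * B"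
    using K(1) B0 by (simp add: C_def O_const_def)
  have calls: "real (oracle_calls 1 K) \<le> O_const * B" if le: "\<epsilon> \<le> max (L * R\<^sup>2) (\<sigma> * R)"
  proof -
    \<comment> \<open>Needed to absorb the \<open>+ 1\<close> in \<open>2 * (K + 1)\<close>: the
      bound on \<open>\<epsilon>\<close> makes \<open>a\<close> or \<open>b\<close> at least 1, and
      its logarithm is at least \<open>1 / 2\<close>.\<close>
    have "1 / 2 \<le> B"
    proof (cases "\<epsilon> \<le> L * R\<^sup>2")
      case True
      then have "1 \<le> a" unfolding a_def using \<epsilon> by simp
      from mult_mono[OF this ta] this show ?thesis by (simp add: B le_max_iff_disj)
    next
      case False
      then have le: "\<epsilon> \<le> \<sigma> * R" using le by simp
      then have \<sigma>: "0 < \<sigma>" using \<epsilon> \<sigma>_nonneg by (cases "\<sigma> = 0") auto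
      have "\<epsilon>\<^sup>2 \<le> (\<sigma> * R)\<^sup>2" using le \<epsilon> by (intro power_mono) auto
      then have b: "1 \<le> b" unfolding b_def using \<epsilon> by (simp add: power_mult_distrib)
      have "2 \<le> b / \<beta>" using large2[OF \<sigma>] by (simp add: b_def)
      then have "1 / 2 \<le> ln (b / \<beta>)"
        using ln2_ge_half ln_le_cancel_iff[of 2 "b / \<beta>"] by linarith
      from mult_mono[OF b this] b show ?thesis by (simp add: B le_max_iff_disj)
    qed
    then show ?thesis using K(1) by (simp add: oracle_calls_def C_def O_const_def)
  qed
  show ?thesis using l1[unfolded l_def] succ iter calls by blast
qed

end

(* The premises on \<epsilon> say that the arguments of the logarithms are at least 2. They do not bound
   \<epsilon> / (L * R^2) when \<beta> is small, and the right-hand sides then tend to 0 while at least two oracle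
   calls are made; hence the additional upper bound on \<epsilon> for the oracle-call estimates only. *)
theorem corollaryC1:
  fixes M :: "'w measure" and D :: "'s measure"
    and G :: "'s \<Rightarrow> real ^ 'd \<Rightarrow> real ^ 'd"
    and F :: "real ^ 'd \<Rightarrow> real ^ 'd"
    and xi1 xi2 :: "nat \<Rightarrow> nat \<Rightarrow> 'w \<Rightarrow> 's"
    and x0 xstar :: "real ^ 'd"
    and R L \<sigma> \<beta> :: real
  assumes "prob_space D" and "prob_space M"
    and "(\<lambda>(s, x). G s x) \<in> borel_measurable (D \<Otimes>\<^sub>M borel)"
    and "\<And>x. integrable D (\<lambda>s. G s x)"
    and "\<And>x. F x = (LINT s|D. G s x)"
    and "prob_space.indep_vars M (\<lambda>_. D)
           (case_sum (\<lambda>(k, i). xi1 k i) (\<lambda>(k, i). xi2 k i))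
           (UNIV :: (nat \<times> nat + nat \<times> nat) set)"
    and "\<And>k i. distr M D (xi1 k i) = D" and "\<And>k i. distr M D (xi2 k i) = D"
    and "xstar \<in> {x. F x = 0}"
    and "\<And>x. x \<in> {x. F x = 0} \<Longrightarrow> norm (x0 - xstar) \<le> norm (x0 - x)"
    and "0 < R" and "norm (x0 - xstar) \<le> R"
    and "0 \<le> \<sigma>" and "0 < L"
    and "\<And>x. x \<in> cball xstar (4 * R) \<Longrightarrow> integrable D (\<lambda>s. (norm (G s x - F x))\<^sup>2)"
    and "\<And>x. x \<in> cball xstar (4 * R) \<Longrightarrow> (LINT s|D. (norm (G s x - F x))\<^sup>2) \<le> \<sigma>\<^sup>2"
    and "\<And>x y. x \<in> cball xstar (4 * R) \<Longrightarrow> y \<in> cball xstar (4 * R) \<Longrightarrow>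
           norm (F x - F y) \<le> L * norm (x - y)"
    and "\<And>x y. x \<in> cball xstar (4 * R) \<Longrightarrow> y \<in> cball xstar (4 * R) \<Longrightarrow>
           (F x - F y) \<bullet> (x - y) \<ge> 0"
    and "0 < \<beta>" and "\<beta> \<le> 1"
  shows
    "(\<forall>K. log_factor K \<beta> \<ge> 1 \<longrightarrow>
        stepsize_cond L K \<beta> (large_stepsize L K \<beta>) \<and>
        batch_cond R \<sigma> K \<beta> (large_stepsize L K \<beta>) (large_batch L R \<sigma> K \<beta>) \<and>
        seg_success_prob M G F xi1 xi2 x0 xstar R \<beta> K
          (large_stepsize L K \<beta>) (large_batch L R \<sigma> K \<beta>)
          (720 * L * R\<^sup>2 * log_factor K \<beta> / (real K + 1)) \<ge> 1 - \<beta>)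
     \<and>
     (\<forall>\<epsilon>>0. L * R\<^sup>2 / (\<epsilon> * \<beta>) \<ge> 2 \<longrightarrow>
        (\<exists>K. log_factor K \<beta> \<ge> 1 \<and>
           seg_success_prob M G F xi1 xi2 x0 xstar R \<beta> K
             (large_stepsize L K \<beta>) (large_batch L R \<sigma> K \<beta>) \<epsilon> \<ge> 1 - \<beta> \<and>
           real K \<le> O_const * (L * R\<^sup>2 / \<epsilon> * ln (L * R\<^sup>2 / (\<epsilon> * \<beta>))) \<and>
           (\<epsilon> \<le> L * R\<^sup>2 \<longrightarrow>
              real (oracle_calls (large_batch L R \<sigma> K \<beta>) K)
                \<le> O_const * (max (L * R\<^sup>2 / \<epsilon>) (\<sigma>\<^sup>2 * R\<^sup>2 / \<epsilon>\<^sup>2) *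
                             ln (L * R\<^sup>2 / (\<epsilon> * \<beta>))))))
     \<and>
     (\<forall>K. log_factor K \<beta> \<ge> 1 \<longrightarrow>
        stepsize_cond L K \<beta> (small_stepsize L R \<sigma> K \<beta>) \<and>
        batch_cond R \<sigma> K \<beta> (small_stepsize L R \<sigma> K \<beta>) 1 \<and>
        seg_success_prob M G F xi1 xi2 x0 xstar R \<beta> K (small_stepsize L R \<sigma> K \<beta>) 1
          (max (720 * L * R\<^sup>2 * log_factor K \<beta> / (real K + 1))
               (270 * \<sigma> * R * sqrt (3 * log_factor K \<beta>) / sqrt (real K + 1))) \<ge> 1 - \<beta>)
     \<and>
     (\<forall>\<epsilon>>0. L * R\<^sup>2 / (\<epsilon> * \<beta>) \<ge> 2 \<longrightarrow>
        (\<sigma> > 0 \<longrightarrow> \<sigma>\<^sup>2 * R\<^sup>2 / (\<epsilon>\<^sup>2 * \<beta>) \<ge> 2) \<longrightarrow>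
        (\<exists>K. log_factor K \<beta> \<ge> 1 \<and>
           seg_success_prob M G F xi1 xi2 x0 xstar R \<beta> K (small_stepsize L R \<sigma> K \<beta>) 1 \<epsilon>
             \<ge> 1 - \<beta> \<and>
           real K \<le> O_const *
             max (L * R\<^sup>2 / \<epsilon> * ln (L * R\<^sup>2 / (\<epsilon> * \<beta>)))
                 (\<sigma>\<^sup>2 * R\<^sup>2 / \<epsilon>\<^sup>2 * ln (\<sigma>\<^sup>2 * R\<^sup>2 / (\<epsilon>\<^sup>2 * \<beta>))) \<and>
           (\<epsilon> \<le> max (L * R\<^sup>2) (\<sigma> * R) \<longrightarrow>
              real (oracle_calls 1 K) \<le> O_const *
                max (L * R\<^sup>2 / \<epsilon> * ln (L * R\<^sup>2 / (\<epsilon> * \<beta>)))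
                    (\<sigma>\<^sup>2 * R\<^sup>2 / \<epsilon>\<^sup>2 * ln (\<sigma>\<^sup>2 * R\<^sup>2 / (\<epsilon>\<^sup>2 * \<beta>))))))"
proof -
  interpret seg_problem M D G F xi1 xi2 x0 xstar R L \<sigma> \<beta>
    by (rule seg_problem.intro) (use assms in auto)
  have "stepsize_cond L K \<beta> (large_stepsize L K \<beta>) \<and>
      batch_cond R \<sigma> K \<beta> (large_stepsize L K \<beta>) (large_batch L R \<sigma> K \<beta>) \<and>
      seg_success_prob M G F xi1 xi2 x0 xstar R \<beta> K
        (large_stepsize L K \<beta>) (large_batch L R \<sigma> K \<beta>)
        (720 * L * R\<^sup>2 * log_factor K \<beta> / (real K + 1)) \<ge> 1 - \<beta>" for K
    using large_stepsize_cond large_batch_cond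
      success_prob[OF large_stepsize_cond large_batch_cond eq_refl[OF large_gap_bound]] by simp
  moreover have "stepsize_cond L K \<beta> (small_stepsize L R \<sigma> K \<beta>) \<and>
      batch_cond R \<sigma> K \<beta> (small_stepsize L R \<sigma> K \<beta>) 1 \<and>
      seg_success_prob M G F xi1 xi2 x0 xstar R \<beta> K (small_stepsize L R \<sigma> K \<beta>) 1
        (max (720 * L * R\<^sup>2 * log_factor K \<beta> / (real K + 1))
             (270 * \<sigma> * R * sqrt (3 * log_factor K \<beta>) / sqrt (real K + 1))) \<ge> 1 - \<beta>" for K
    using small_stepsize_cond small_batch_cond
      success_prob[OF small_stepsize_cond small_batch_cond small_gap_bound] by simp
  ultimately show ?thesis
    by (intro conjI[OF _ conjI[OF _ conjI]] allI impI complexity_large complexity_small) blast+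
qed

end
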